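(* Let $\mu_0>0$, let $k$ range over a finite index set, and let $A_s>0$, $J_{s,k}>0$, $\chi_k\ge 0$ and $\mathbf{J}_{k,p}\in\mathbb{R}^3$ be given. Let $w^*(\cdot;\mathbf{J}_p):\mathbb{R}^3\to\mathbb{R}$ be the co-energy density and $\mathbb{S}_{\mathbf{B}}(\mathbf{H})$ the matrices defined in the context, and set $c_1=\mu_0$ and $c_2=\mu_0+\frac{2\sum_k J_{s,k}}{A_s\pi}$. Let $\mathbf{B}\in\mathbb{R}^3$ be given and define $$f(\mathbf{H})=w^*(\mathbf{H};\mathbf{J}_p)-\langle \mathbf{B},\mathbf{H}\rangle,\qquad \mathbf{H}\in\mathbb{R}^3 .$$ Fix line-search parameters $0<\sigma<\tfrac12$ and $0<\rho<1$. For $\mathbf{H}^0\in\mathbb{R}^3$ and matrices $\mathbb{S}^n\in\mathbb{R}^{3\times 3}$, $n\ge 0$, define the iterates $$\mathbf{H}^{n+1}=\mathbf{H}^n+\alpha^n\,\delta\mathbf{H}^n,\qquad \delta\mathbf{H}^n=-\mathbb{S}^n\nabla f(\mathbf{H}^n),$$ $$\alpha^n=\max\{\alpha=\rho^m:\ \phi_n(\alpha)\le\phi_n(0)+\sigma\alpha\,\phi_n'(0),\ m\in\mathbb{Z},\ m\ge 0\},\qquad \phi_n(\alpha)=f(\mathbf{H}^n+\alpha\,\delta\mathbf{H}^n).$$ Assume that the matrices $\mathbb{S}^n$ are symmetric and positive definite, with all eigenvalues $\lambda(\mathbb{S}^n)$ satisfying $0<c_3\le\lambda(\mathbb{S}^n)\le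 c_4$ for all $n$. Then for any $\mathbf{H}^0\in\mathbb{R}^3$ the iterates $\mathbf{H}^n$ converge to the unique minimizer $\mathbf{H}$ of $f$ over $\mathbb{R}^3$ at a linear rate, i.e., $|\mathbf{H}^n-\mathbf{H}|\le C\,q^n\,|\mathbf{H}^0-\mathbf{H}|$ for all $n\ge 0$ with some constant $C>0$ and a contraction factor $q\in(0,1)$, where (for fixed line-search parameters $\sigma,\rho$) $q$ depends only on $c_1,c_2,c_3,c_4$. Moreover, for the choice $\mathbb{S}^n=\big(\mathbb{S}_{\mathbf{B}}(\mathbf{H}^n)\big)^{-1}$, $n\ge 0$, the convergence is locally superlinear, i.e., $|\mathbf{H}^{n+1}-\mathbf{H}|=o(|\mathbf{H}^n-\mathbf{H}|)$ as $n\to\infty$.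
   Context: Notation: $|\cdot|$ and $\langle\cdot,\cdot\rangle$ are the Euclidean norm and inner product on $\mathbb{R}^3$, $I$ is the $3\times3$ identity matrix, $a\otimes b=ab^\top$, and $\mathbf{J}_p=\{\mathbf{J}_{k,p}\}_k$. Internal energy densities: $U_k(\mathbf{J})=-\frac{2A_sJ_{s,k}}{\pi}\log\big(\cos\big(\frac{\pi}{2}\frac{|\mathbf{J}|}{J_{s,k}}\big)\big)$ for $|\mathbf{J}|<J_{s,k}$, and $U_k(\mathbf{J})=+\infty$ for $|\mathbf{J}|\ge J_{s,k}$. Partial polarizations: for $\mathbf{H}\in\mathbb{R}^3$, $\mathbf{J}_k=\mathbf{J}_k(\mathbf{H};\mathbf{J}_{k,p})$ denotes the unique minimizer over $\mathbf{J}\in\mathbb{R}^3$ of $U_k(\mathbf{J})-\langle\mathbf{J},\mathbf{H}\rangle+\chi_k|\mathbf{J}-\mathbf{J}_{k,p}|$. Co-energy density: $$w^*(\mathbf{H};\mathbf{J}_p)=\frac{\mu_0}{2}|\mathbf{H}|^2-\sum_k\min_{\mathbf{J}}\Big(U_k(\mathbf{J})-\langle\mathbf{H},\mathbf{J}\rangle+\chi_k|\mathbf{J}-\mathbf{J}_{k,p}|\Big).$$ It is continuously differentiable in $\mathbf{H}$, with gradient $\nabla_{\mathbf{H}}w^*(\mathbf{H};\mathbf{J}_p)=\mathbf{B}(\mathbf{H};\mathbf{J}_p):=\mu_0\mathbf{H}+\sum_k\mathbf{J}_k(\mathbf{H};\mathbf{J}_{k,p})$ (the forward hysteresis operator). Generalized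 Jacobian: $\mathbb{S}_{\mathbf{B}}(\mathbf{H})=\mu_0I+\sum_k\mathbb{S}^k_{\mathbf{J}}(\mathbf{H})$, where, with $\mathbf{J}_k=\mathbf{J}_k(\mathbf{H};\mathbf{J}_{k,p})$, $\mathbb{S}^k_{\mathbf{J}}(\mathbf{H})=0$ if $\mathbf{J}_k=\mathbf{J}_{k,p}$, and if $\mathbf{J}_k\ne\mathbf{J}_{k,p}$, $$\mathbb{S}^k_{\mathbf{J}}(\mathbf{H})=\Big(\nabla^2U_k(\mathbf{J}_k)+\frac{\chi_k}{|\mathbf{J}_k-\mathbf{J}_{k,p}|}\Big(I-\frac{(\mathbf{J}_k-\mathbf{J}_{k,p})\otimes(\mathbf{J}_k-\mathbf{J}_{k,p})}{|\mathbf{J}_k-\mathbf{J}_{k,p}|^2}\Big)\Big)^{-1}.$$ *)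

theory Defs
  imports "HOL-Analysis.Analysis" "HOL-Library.Landau_Symbols"
begin

definition gradient :: "('a::real_inner \<Rightarrow> real) \<Rightarrow> 'a \<Rightarrow> 'a" where
  "gradient f x = (THE D. GDERIV f x :> D)"

definition hessian :: "(real^'n \<Rightarrow> real) \<Rightarrow> real^'n \<Rightarrow> real^'n^'n" where
  "hessian f x = jacobian (gradient f) (at x)"

definition outer :: "real^'n \<Rightarrow> real^'m \<Rightarrow> real^'m^'n" where
  "outer a b = (\<chi> i j. a $ i * b $ j)"

definition eigenvalue :: "real^'n^'n \<Rightarrow> real \<Rightarrow> bool" where
  "eigenvalue A l \<longleftrightarrow> (\<exists>v. v \<noteq> 0 \<and> A *v v = l *\<^sub>R v)"

definition sym_pos_def :: "real^'n^'n \<Rightarrow> bool" where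
  "sym_pos_def A \<longleftrightarrow> transpose A = A \<and> (\<forall>x. x \<noteq> 0 \<longrightarrow> 0 < x \<bullet> (A *v x))"

definition internal_energy :: "real \<Rightarrow> real \<Rightarrow> real^3 \<Rightarrow> ereal" where
  "internal_energy As Js J =
    (if norm J < Js
     then ereal (- (2 * As * Js / pi) * ln (cos (pi / 2 * (norm J / Js))))
     else \<infinity>)"

text \<open>
  The pinning coefficient, usually written with the Greek letter chi, is called \<open>\<kappa>\<close> because
  that letter is the binder for vectors.
\<close>

definition pol_energy ::
  "real \<Rightarrow> real \<Rightarrow> real \<Rightarrow> real^3 \<Rightarrow> real^3 \<Rightarrow> real^3 \<Rightarrow> ereal" where
  "pol_energy As Js \<kappa> Jp H J =
    internal_energy As Js J - ereal (J \<bullet> H) + ereal (\<kappa> * norm (J - Jp))"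

definition polarization ::
  "real \<Rightarrow> real \<Rightarrow> real \<Rightarrow> real^3 \<Rightarrow> real^3 \<Rightarrow> real^3" where
  "polarization As Js \<kappa> Jp H =
    (THE J. is_arg_min (pol_energy As Js \<kappa> Jp H) (\<lambda>_. True) J)"

text \<open>
  The infimum below is attained and finite, so it is the minimum and the
  conversion to a real number loses nothing.
\<close>

definition coenergy ::
  "nat set \<Rightarrow> real \<Rightarrow> real \<Rightarrow> (nat \<Rightarrow> real) \<Rightarrow> (nat \<Rightarrow> real) \<Rightarrow> (nat \<Rightarrow> real^3)
    \<Rightarrow> real^3 \<Rightarrow> real" where
  "coenergy K \<mu>0 As Js \<kappa> Jp H =
    \<mu>0 / 2 * (norm H)\<^sup>2
      - (\<Sum>k\<in>K. real_of_ereal (INF J. pol_energy As (Js k) (\<kappa> k) (Jp k) H J))"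

text \<open>
  The Hessian of the internal energy is only needed at polarizations, which lie in the
  open ball where that energy is finite; the value \<open>0\<close> that \<^const>\<open>real_of_ereal\<close> produces
  outside of it is therefore irrelevant.
\<close>

definition gen_jacobian_pol ::
  "real \<Rightarrow> real \<Rightarrow> real \<Rightarrow> real^3 \<Rightarrow> real^3 \<Rightarrow> real^3^3" where
  "gen_jacobian_pol As Js \<kappa> Jp H =
    (let J = polarization As Js \<kappa> Jp H; d = J - Jp in
      if J = Jp then 0
      else matrix_inv
        (hessian (\<lambda>X. real_of_ereal (internal_energy As Js X)) J
          + (\<kappa> / norm d) *\<^sub>R (mat 1 - (1 / (norm d)\<^sup>2) *\<^sub>R outer d d)))"

definition gen_jacobian ::
  "nat set \<Rightarrow> real \<Rightarrow> real \<Rightarrow> (nat \<Rightarrow> real) \<Rightarrow> (nat \<Rightarrow> real) \<Rightarrow> (nat \<Rightarrow> real^3)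
    \<Rightarrow> real^3 \<Rightarrow> real^3^3" where
  "gen_jacobian K \<mu>0 As Js \<kappa> Jp H =
    \<mu>0 *\<^sub>R mat 1 + (\<Sum>k\<in>K. gen_jacobian_pol As (Js k) (\<kappa> k) (Jp k) H)"

definition armijo_step ::
  "(real^'n \<Rightarrow> real) \<Rightarrow> real \<Rightarrow> real \<Rightarrow> real^'n \<Rightarrow> real^'n \<Rightarrow> real" where
  "armijo_step f \<sigma> \<rho> H d =
    (let \<phi> = (\<lambda>\<alpha>. f (H + \<alpha> *\<^sub>R d)) in
      GREATEST \<alpha>. (\<exists>m::nat. \<alpha> = \<rho> ^ m) \<and> \<phi> \<alpha> \<le> \<phi> 0 + \<sigma> * \<alpha> * deriv \<phi> 0)"

text \<open>
  The iteration is a relation between the sequence of matrices and the sequence of points,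
  because the matrices may be chosen depending on the current iterate.
\<close>

definition line_search_iterates ::
  "(real^'n \<Rightarrow> real) \<Rightarrow> real \<Rightarrow> real \<Rightarrow> (nat \<Rightarrow> real^'n^'n) \<Rightarrow> (nat \<Rightarrow> real^'n) \<Rightarrow> bool" where
  "line_search_iterates f \<sigma> \<rho> S H \<longleftrightarrow>
    (\<forall>n. let d = - (S n *v gradient f (H n)) in
      H (Suc n) = H n + armijo_step f \<sigma> \<rho> (H n) d *\<^sub>R d)"

end

theory Submission
  imports Defs
begin

text \<open>
  Each partial polarization minimizes a function with convexity modulus \<open>As * pi / (2 * Js k)\<close>, so
  by duality the co-energy satisfies quadratic lower and upper bounds with constants \<open>c1\<close> and
  \<open>c2\<close>. The upper bound makes the Armijo rule accept steps bounded away from zero; the lower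
  bound gives a Polyak-Lojasiewicz inequality, hence a fixed decrease factor of the cost.

  For the superlinear rate two estimates at the minimizer \<open>z\<close> are needed: semismoothness,
  \<open>g H - A H (H - z) = o(norm (H - z))\<close> for the gradient \<open>g\<close> and the generalized Jacobian \<open>A\<close>,
  and the trapezoidal rule \<open>f H - f z = g H \<bullet> (H - z) / 2 + o((norm (H - z))\<^sup>2)\<close>, which
  implies that the full Newton step passes the Armijo test because \<open>\<sigma> < 1 / 2\<close>. Away from the
  pinning point both follow from expanding the equilibrium condition, in which the field is a
  smooth function of the polarization, so that no inverse function theorem is needed. The singular
  case is a pinned polarization whose pull has norm exactly \<open>\<kappa>\<close>; there the change of direction of
  the pull is almost orthogonal to the displacement, and in such directions the Jacobian vanishes
  like the displacement.
\<close>

section \<open>Line search for functions between two quadratics\<close>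

text \<open>The trapezoidal rule replaces it. If \<open>d\<close> is nearly \<open>z - x\<close>,
  then \<open>f (x + d) - f x\<close> is nearly \<open>- (g x \<bullet> (x - z)) / 2\<close>,
  whereas the Armijo test asks for about \<open>- \<sigma> * (g x \<bullet> (x - z))\<close>; by
  strong convexity the slack \<open>1 / 2 - \<sigma>\<close> is worth a multiple of the squared
  distance. The modulus \<open>As * pi / (2 * Js k)\<close> is the slope of the force law at the
  origin, where it is least. Its reciprocal bounds the curvature of the dual term, and these
  reciprocals together with \<open>\<mu>0\<close> add up to \<open>c2\<close>, while
  \<open>c1\<close> stems from the magnetic term \<open>\<mu>0 / 2 * (norm H)\<^sup>2\<close>
  alone.\<close>

lemma gradient_eq:
  assumes "GDERIV f x :> D"
  shows "gradient f x = D"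
  unfolding gradient_def
proof (rule the_equality)
  show "GDERIV f x :> D" by (rule assms)
  fix D' assume "GDERIV f x :> D'"
  with assms have "(\<lambda>h. h \<bullet> D') = (\<lambda>h. h \<bullet> D)"
    unfolding gderiv_def by (rule has_derivative_unique[rotated])
  then show "D' = D"
    by (metis inner_eq_zero_iff inner_diff_right right_minus_eq)
qed

text \<open>The remainder lies between zero and a quadratic. The co-energy obtains its gradient this
  way, from inequalities on values and without differentiating the minimizer.\<close>

lemma GDERIV_if_quadratic_bounds:
  fixes f :: "'a::real_inner \<Rightarrow> real"
  assumes lower: "\<And>y. f x + D \<bullet> (y - x) \<le> f y"
    and upper: "\<And>y. f y \<le> f x + D \<bullet> (y - x) + L * (norm (y - x))\<^sup>2"
  shows "GDERIV f x :> D"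
  unfolding gderiv_def
proof (rule has_derivativeI)
  show "bounded_linear (\<lambda>h. h \<bullet> D)" by (rule bounded_linear_inner_left)
  have "((\<lambda>y. \<bar>L\<bar> * norm (y - x)) \<longlongrightarrow> \<bar>L\<bar> * norm (x - x)) (at x)"
    by (intro tendsto_intros)
  then have lim: "((\<lambda>y. \<bar>L\<bar> * norm (y - x)) \<longlongrightarrow> 0) (at x)" by simp
  show "((\<lambda>y. (f y - f x - (y - x) \<bullet> D) /\<^sub>R norm (y - x)) \<longlongrightarrow> 0) (at x)"
  proof (rule Lim_null_comparison[OF _ lim])
    show "\<forall>\<^sub>F y in at x. norm ((f y - f x - (y - x) \<bullet> D) /\<^sub>R norm (y - x)) \<le> \<bar>L\<bar> * norm (y - x)"
    proof (rule eventuallyI)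
      fix y
      have "\<bar>f y - f x - (y - x) \<bullet> D\<bar> \<le> \<bar>L\<bar> * (norm (y - x))\<^sup>2"
        using lower[of y] upper[of y] mult_right_mono[OF abs_ge_self[of L], of "(norm (y - x))\<^sup>2"]
        by (simp add: inner_commute)
      then show "norm ((f y - f x - (y - x) \<bullet> D) /\<^sub>R norm (y - x)) \<le> \<bar>L\<bar> * norm (y - x)"
        by (cases "y = x") (simp_all add: field_simps power2_eq_square)
    qed
  qed
qed

text \<open>Powers of \<open>\<rho>\<close> decrease, so the largest accepted step belongs to the
  least accepted exponent; acceptance at \<open>m\<^sub>0\<close> makes the \<open>GREATEST\<close>
  meaningful. The rejection of smaller exponents later bounds the step from below.\<close>

lemma armijo_stepE:
  assumes \<rho>: "0 < \<rho>" "\<rho> < 1"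
    and deriv: "deriv (\<lambda>\<alpha>. f (x + \<alpha> *\<^sub>R d)) 0 = s"
    and ex: "f (x + \<rho> ^ m\<^sub>0 *\<^sub>R d) \<le> f x + \<sigma> * \<rho> ^ m\<^sub>0 * s"
  obtains m where "armijo_step f \<sigma> \<rho> x d = \<rho> ^ m" "m \<le> m\<^sub>0"
    "f (x + \<rho> ^ m *\<^sub>R d) \<le> f x + \<sigma> * \<rho> ^ m * s"
    "\<And>i. i < m \<Longrightarrow> \<not> f (x + \<rho> ^ i *\<^sub>R d) \<le> f x + \<sigma> * \<rho> ^ i * s"
proof -
  let ?P = "\<lambda>m. f (x + \<rho> ^ m *\<^sub>R d) \<le> f x + \<sigma> * \<rho> ^ m * s"
  define m where "m = (LEAST m. ?P m)"
  have Pm: "?P m" unfolding m_def by (rule LeastI[of ?P, OF ex])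
  have min: "\<not> ?P i" if "i < m" for i using that not_less_Least m_def by blast
  have "armijo_step f \<sigma> \<rho> x d = \<rho> ^ m"
    unfolding armijo_step_def Let_def deriv
  proof (rule Greatest_equality)
    show "(\<exists>i. \<rho> ^ m = \<rho> ^ i) \<and> f (x + \<rho> ^ m *\<^sub>R d) \<le> f (x + 0 *\<^sub>R d) + \<sigma> * \<rho> ^ m * s"
      using Pm by auto
  next
    fix y assume "(\<exists>i. y = \<rho> ^ i) \<and> f (x + y *\<^sub>R d) \<le> f (x + 0 *\<^sub>R d) + \<sigma> * y * s"
    then obtain i where i: "y = \<rho> ^ i" "?P i" by auto
    then have "m \<le> i" using min not_less by blast
    then show "y \<le> \<rho> ^ m" using i \<rho> by (simp add: power_decreasing)
  qed
  moreover have "m \<le> m\<^sub>0" unfolding m_def by (rule Least_le[of ?P, OF ex])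
  ultimately show ?thesis using that Pm min by blast
qed

text \<open>Strong convexity and smoothness in terms of values only. That \<open>g\<close> is the
  gradient is a consequence, which suits a cost defined through minima.\<close>

locale quadratic_sandwich =
  fixes f :: "real^'n \<Rightarrow> real" and g :: "real^'n \<Rightarrow> real^'n" and m L :: real
  assumes m_pos: "0 < m" and m_le_L: "m \<le> L"
    and lower: "\<And>x y. f x + g x \<bullet> (y - x) + m / 2 * (norm (y - x))\<^sup>2 \<le> f y"
    and upper: "\<And>x y. f y \<le> f x + g x \<bullet> (y - x) + L / 2 * (norm (y - x))\<^sup>2"
begin

lemma L_pos: "0 < L" using m_pos m_le_L by simp

lemma has_gradient: "GDERIV f x :> g x"
proof (rule GDERIV_if_quadratic_bounds)
  show "f x + g x \<bullet> (y - x) \<le> f y" for y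
    using lower[of x y] m_pos zero_le_power2[of "norm (y - x)"]
    by (smt (verit, best) divide_nonneg_pos mult_nonneg_nonneg)
qed (rule upper)

lemma gradient_f: "gradient f x = g x"
  by (rule gradient_eq[OF has_gradient])

lemma deriv_along: "deriv (\<lambda>\<alpha>. f (x + \<alpha> *\<^sub>R d)) 0 = g x \<bullet> d"
proof (rule DERIV_imp_deriv)
  have "(f has_derivative (\<lambda>h. h \<bullet> g x)) (at (x + 0 *\<^sub>R d))"
    using has_gradient[of x] by (simp add: gderiv_def)
  then have "((\<lambda>\<alpha>. f (x + \<alpha> *\<^sub>R d)) has_derivative (\<lambda>t. (0 + t *\<^sub>R d) \<bullet> g x)) (at 0)"
    by (rule has_derivative_compose[rotated]) (auto intro!: derivative_eq_intros)
  then show "((\<lambda>\<alpha>. f (x + \<alpha> *\<^sub>R d)) has_real_derivative g x \<bullet> d) (at 0)"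
    by (simp add: has_field_derivative_def inner_commute mult.commute[of _ "d \<bullet> g x"])
qed

lemma continuous_f: "continuous_on S f"
  using has_gradient unfolding gderiv_def
  by (meson continuous_at_imp_continuous_on has_derivative_continuous)

lemma gradient_zero_iff_min: "is_arg_min f (\<lambda>_. True) x \<longleftrightarrow> g x = 0"
proof
  assume "is_arg_min f (\<lambda>_. True) x"
  then have min: "f x \<le> f y" for y by (auto simp: is_arg_min_def not_less)
  \<comment> \<open>The step of length \<open>1 / L\<close> minimizes the upper quadratic model; its
    gain \<open>(norm (g x))\<^sup>2 / (2 * L)\<close> must vanish at a minimizer.\<close>
  have "f (x - (1 / L) *\<^sub>R g x) \<le> f x - (1 / L) * (norm (g x))\<^sup>2 + L / 2 * (1 / L * norm (g x))\<^sup>2"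
    using upper[of "x - (1 / L) *\<^sub>R g x" x] L_pos by (simp add: dot_square_norm)
  also have "\<dots> = f x - 1 / (2 * L) * (norm (g x))\<^sup>2"
    using L_pos by (simp add: field_simps power2_eq_square)
  finally have "1 / (2 * L) * (norm (g x))\<^sup>2 \<le> 0" using min[of "x - (1 / L) *\<^sub>R g x"] by simp
  then show "g x = 0" using L_pos by (simp add: field_simps)
next
  assume "g x = 0"
  then have "f x \<le> f y" for y
    using lower[of x y] m_pos zero_le_power2[of "norm (y - x)"]
    by (smt (verit, best) divide_nonneg_pos mult_nonneg_nonneg inner_zero_left)
  then show "is_arg_min f (\<lambda>_. True) x" by (simp add: is_arg_min_def not_less)
qed

lemma ex1_min: "\<exists>!x. is_arg_min f (\<lambda>_. True) x"
proof (rule ex_ex1I)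
  \<comment> \<open>Beyond radius \<open>R\<close> the lower quadratic at \<open>0\<close> outweighs
    its linear term, so the minimum over the ball is global.\<close>
  define R where "R = 2 * norm (g 0) / m"
  have "0 \<le> R" using m_pos by (simp add: R_def)
  have "compact (cball (0::real^'n) R)" "cball (0::real^'n) R \<noteq> {}"
    using \<open>0 \<le> R\<close> by auto
  from continuous_attains_inf[OF this continuous_f]
  obtain x where x: "x \<in> cball 0 R" "\<And>y. y \<in> cball 0 R \<Longrightarrow> f x \<le> f y" by blast
  have "f x \<le> f y" for y
  proof (cases "norm y \<le> R")
    case False
    have "\<bar>g 0 \<bullet> y\<bar> \<le> norm (g 0) * norm y" by (rule Cauchy_Schwarz_ineq2)
    also have "norm (g 0) * norm y = m / 2 * (R * norm y)" using m_pos by (simp add: R_def)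
    also have "\<dots> \<le> m / 2 * (norm y * norm y)"
      using False m_pos by (intro mult_left_mono mult_right_mono) auto
    finally have "f 0 \<le> f y" using lower[of 0 y] by (simp add: power2_eq_square)
    moreover have "f x \<le> f 0" using x(2)[of 0] \<open>0 \<le> R\<close> by simp
    ultimately show ?thesis by simp
  qed (use x in auto)
  then show "\<exists>x. is_arg_min f (\<lambda>_. True) x" by (auto simp: is_arg_min_def not_less)
next
  fix x y assume x: "is_arg_min f (\<lambda>_. True) x" and y: "is_arg_min f (\<lambda>_. True) y"
  have "g x = 0" using x by (rule gradient_zero_iff_min[THEN iffD1])
  moreover have "f y \<le> f x" using y by (simp add: is_arg_min_def not_less)
  ultimately have "m / 2 * (norm (y - x))\<^sup>2 \<le> 0" using lower[of x y] by simp
  then show "x = y" using m_pos by (simp add: mult_le_0_iff)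
qed

lemma monotone: "m * (norm (y - x))\<^sup>2 \<le> (g y - g x) \<bullet> (y - x)"
  using lower[of x y] lower[of y x]
  by (simp add: norm_minus_commute inner_diff algebra_simps)

text \<open>The Polyak-Lojasiewicz inequality when \<open>y\<close> is the minimizer: the lower
  quadratic model at \<open>x\<close> is minimized over its argument by completing the
  square.\<close>

lemma gradient_dominates: "2 * m * (f x - f y) \<le> (norm (g x))\<^sup>2"
proof -
  have "0 \<le> (norm (g x + m *\<^sub>R (y - x)))\<^sup>2" by simp
  also have "\<dots> = (norm (g x))\<^sup>2 + 2 * m * (g x \<bullet> (y - x)) + m * m * (norm (y - x))\<^sup>2"
    by (simp add: power2_norm_eq_inner inner_add inner_commute algebra_simps)
  finally show ?thesis
    using mult_left_mono[OF lower[of x y], of "2 * m"] m_pos by (simp add: algebra_simps)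
qed

text \<open>The gradient step from \<open>x\<close> gains at least
  \<open>(norm (g x))\<^sup>2 / (2 * L)\<close>, which cannot exceed \<open>f x - f y\<close>, and
  this gap is at most \<open>L / 2 * (norm (x - y))\<^sup>2\<close>.\<close>

lemma norm_gradient_le:
  assumes "g y = 0"
  shows "norm (g x) \<le> L * norm (x - y)"
proof (rule power2_le_imp_le)
  have "f y \<le> f (x - (1 / L) *\<^sub>R g x)" using assms
    by (metis gradient_zero_iff_min is_arg_min_def not_less)
  also have "f (x - (1 / L) *\<^sub>R g x) \<le> f x - (1 / L) * (norm (g x))\<^sup>2 + L / 2 * (1 / L * norm (g x))\<^sup>2"
    using upper[of "x - (1 / L) *\<^sub>R g x" x] L_pos by (simp add: dot_square_norm)
  also have "\<dots> = f x - 1 / (2 * L) * (norm (g x))\<^sup>2"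
    using L_pos by (simp add: field_simps power2_eq_square)
  finally have "1 / (2 * L) * (norm (g x))\<^sup>2 \<le> L / 2 * (norm (x - y))\<^sup>2"
    using upper[of x y] assms by simp
  then show "(norm (g x))\<^sup>2 \<le> (L * norm (x - y))\<^sup>2"
    using L_pos by (simp add: field_simps power2_eq_square)
  show "0 \<le> L * norm (x - y)" using L_pos by simp
qed

text \<open>Here \<open>a\<close> measures the descent and \<open>b\<close> the length of the
  direction; they become the eigenvalue bounds \<open>c3\<close> and \<open>c4\<close>. The step is
  either 1 or at least \<open>\<rho>\<close> times the threshold up to which the upper quadratic
  guarantees acceptance.\<close>

lemma armijo_decrease:
  assumes \<sigma>: "0 < \<sigma>" "\<sigma> < 1" and \<rho>: "0 < \<rho>" "\<rho> < 1"
    and bounds: "0 < a" "0 < b" "a * (norm (g x))\<^sup>2 \<le> - (g x \<bullet> d)" "(norm d)\<^sup>2 \<le> b * - (g x \<bullet> d)"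
  shows "f (x + armijo_step f \<sigma> \<rho> x d *\<^sub>R d)
    \<le> f x - \<sigma> * min 1 (2 * \<rho> * (1 - \<sigma>) / (L * b)) * a * (norm (g x))\<^sup>2"
proof -
  define s where "s = - (g x \<bullet> d)"
  \<comment> \<open>Up to \<open>T\<close> the quadratic term of the upper model costs at most the
    share \<open>1 - \<sigma>\<close> of the first-order decrease
    \<open>\<alpha> * s\<close>.\<close>
  define T where "T = 2 * (1 - \<sigma>) / (L * b)"
  have "0 \<le> s" using bounds(1,3) unfolding s_def by (smt (verit) mult_nonneg_nonneg zero_le_power2)
  have T_pos: "0 < T" using \<sigma> bounds L_pos by (simp add: T_def)
  have ok: "f (x + \<alpha> *\<^sub>R d) \<le> f x + \<sigma> * \<alpha> * - s" if "0 \<le> \<alpha>" "\<alpha> \<le> T" for \<alpha>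
  proof -
    have "f (x + \<alpha> *\<^sub>R d) \<le> f x - \<alpha> * s + L / 2 * (\<alpha> * norm d)\<^sup>2"
      using upper[of "x + \<alpha> *\<^sub>R d" x] by (simp add: s_def power_mult_distrib)
    also have "L / 2 * (\<alpha> * norm d)\<^sup>2 \<le> L / 2 * \<alpha>\<^sup>2 * (b * s)"
      using mult_left_mono[OF bounds(4), of "L / 2 * \<alpha>\<^sup>2"] L_pos
      by (simp add: power_mult_distrib s_def mult.assoc)
    also have "\<dots> = (L * b / 2 * \<alpha>) * (\<alpha> * s)" by (simp add: power2_eq_square)
    also have "\<dots> \<le> (1 - \<sigma>) * (\<alpha> * s)"
      using that \<open>0 \<le> s\<close> bounds L_pos
      by (intro mult_right_mono) (auto simp: T_def field_simps)
    finally show ?thesis by (simp add: algebra_simps)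
  qed
  obtain m0 where "\<rho> ^ m0 < T" using real_arch_pow_inv[OF T_pos \<rho>(2)] by blast
  then have "f (x + \<rho> ^ m0 *\<^sub>R d) \<le> f x + \<sigma> * \<rho> ^ m0 * - s" using ok[of "\<rho> ^ m0"] \<rho> by simp
  from armijo_stepE[OF \<rho> _ this]
  obtain k where k: "armijo_step f \<sigma> \<rho> x d = \<rho> ^ k"
    "f (x + \<rho> ^ k *\<^sub>R d) \<le> f x + \<sigma> * \<rho> ^ k * - s"
    "\<And>i. i < k \<Longrightarrow> \<not> f (x + \<rho> ^ i *\<^sub>R d) \<le> f x + \<sigma> * \<rho> ^ i * - s"
    by (auto simp: deriv_along s_def)
  \<comment> \<open>If \<open>k\<close> is positive, the preceding power was rejected and hence
    exceeds \<open>T\<close>.\<close>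
  have "min 1 (\<rho> * T) \<le> \<rho> ^ k"
  proof (cases k)
    case (Suc i)
    then have "T < \<rho> ^ i" using k(3)[of i] ok[of "\<rho> ^ i"] \<rho> by force
    then have "\<rho> * T \<le> \<rho> ^ k" using \<rho> Suc by simp
    then show ?thesis by simp
  qed simp
  moreover have "min 1 (\<rho> * T) = min 1 (2 * \<rho> * (1 - \<sigma>) / (L * b))" by (simp add: T_def algebra_simps)
  ultimately have "min 1 (2 * \<rho> * (1 - \<sigma>) / (L * b)) * (a * (norm (g x))\<^sup>2) \<le> \<rho> ^ k * s"
    using bounds(1,3) \<rho> by (intro mult_mono) (auto simp: s_def)
  then have "\<sigma> * (min 1 (2 * \<rho> * (1 - \<sigma>) / (L * b)) * (a * (norm (g x))\<^sup>2)) \<le> \<sigma> * (\<rho> ^ k * s)"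
    using \<sigma> by simp
  then show ?thesis using k(1,2) by (simp add: algebra_simps)
qed

text \<open>The cost gap contracts by \<open>\<theta>\<close> and is comparable to the squared
  distance with constants \<open>m / 2\<close> and \<open>L / 2\<close>, hence the square roots.
  Leaving \<open>\<theta>\<close> free above the computed factor allows it to be chosen
  positive.\<close>

lemma linear_convergence:
  assumes \<sigma>: "0 < \<sigma>" "\<sigma> < 1" and \<rho>: "0 < \<rho>" "\<rho> < 1" and ab: "0 < a" "0 < b"
    and step: "\<And>n. H (Suc n) = H n + armijo_step f \<sigma> \<rho> (H n) (d n) *\<^sub>R d n"
    and d: "\<And>n. a * (norm (g (H n)))\<^sup>2 \<le> - (g (H n) \<bullet> d n)"
      "\<And>n. (norm (d n))\<^sup>2 \<le> b * - (g (H n) \<bullet> d n)"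
    and \<theta>: "0 < \<theta>" "1 - 2 * \<sigma> * min 1 (2 * \<rho> * (1 - \<sigma>) / (L * b)) * a * m \<le> \<theta>"
    and z: "g z = 0"
  shows "norm (H n - z) \<le> sqrt (L / m) * sqrt \<theta> ^ n * norm (H 0 - z)"
proof -
  define t where "t = min 1 (2 * \<rho> * (1 - \<sigma>) / (L * b))"
  have "0 < t" using \<sigma> \<rho> ab L_pos by (simp add: t_def)
  have fz: "f z \<le> f x" for x using z by (metis gradient_zero_iff_min is_arg_min_def not_less)
  have dec: "f (H (Suc n)) - f z \<le> \<theta> * (f (H n) - f z)" for n
  proof -
    have "f (H (Suc n)) \<le> f (H n) - \<sigma> * t * a * (norm (g (H n)))\<^sup>2"
      unfolding step t_def by (intro armijo_decrease assms)
    also have "\<dots> \<le> f (H n) - \<sigma> * t * a * (2 * m * (f (H n) - f z))"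
      using gradient_dominates[of "H n" z] \<sigma> ab \<open>0 < t\<close> by (intro diff_mono mult_left_mono) auto
    finally have "f (H (Suc n)) - f z \<le> (1 - 2 * \<sigma> * t * a * m) * (f (H n) - f z)"
      by (simp add: algebra_simps)
    also have "\<dots> \<le> \<theta> * (f (H n) - f z)"
      using \<theta>(2) fz[of "H n"] unfolding t_def by (intro mult_right_mono) auto
    finally show ?thesis .
  qed
  have "f (H n) - f z \<le> \<theta> ^ n * (f (H 0) - f z)"
  proof (induction n)
    case (Suc n)
    have "\<theta> * (f (H n) - f z) \<le> \<theta> * (\<theta> ^ n * (f (H 0) - f z))"
      using Suc \<theta>(1) by (intro mult_left_mono) auto
    with dec[of n] show ?case by (simp only: power_Suc mult.assoc)
  qed simp
  also have "\<dots> \<le> \<theta> ^ n * (L / 2 * (norm (H 0 - z))\<^sup>2)"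
    using upper[of "H 0" z] z \<theta>(1) by (intro mult_left_mono) auto
  finally have "m / 2 * (norm (H n - z))\<^sup>2 \<le> \<theta> ^ n * (L / 2 * (norm (H 0 - z))\<^sup>2)"
    using lower[of z "H n"] z by simp
  then have "(norm (H n - z))\<^sup>2 \<le> L / m * \<theta> ^ n * (norm (H 0 - z))\<^sup>2"
    using m_pos by (simp add: field_simps)
  also have "\<dots> = (sqrt (L / m) * sqrt \<theta> ^ n * norm (H 0 - z))\<^sup>2"
    using m_pos L_pos \<theta>(1) by (simp add: power_mult_distrib flip: real_sqrt_power)
  finally show ?thesis
    by (rule power2_le_imp_le) (use m_pos L_pos \<theta>(1) in simp)
qed

text \<open>The cost gap after the step is of order \<open>\<epsilon> * e\<^sup>2\<close>, before it
  about half of \<open>g x \<bullet> (x - z)\<close>. The errors have to fit into the slack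
  \<open>(1 / 2 - \<sigma>) * (g x \<bullet> (x - z))\<close>, which by strong monotonicity is at
  least \<open>(1 / 2 - \<sigma>) * m * e\<^sup>2\<close>.\<close>

lemma newton_step:
  assumes \<sigma>: "0 < \<sigma>" "\<sigma> < 1 / 2" and \<rho>: "0 < \<rho>" "\<rho> < 1" and z: "g z = 0"
    and \<epsilon>: "0 < \<epsilon>" "\<epsilon> \<le> 1" "(L + 1) * (\<epsilon> + \<epsilon>) \<le> (1 / 2 - \<sigma>) * m"
    and newton: "norm (x + d - z) \<le> \<epsilon> * norm (x - z)"
    and trapezoid: "\<bar>f x - f z - g x \<bullet> (x - z) / 2\<bar> \<le> \<epsilon> * (norm (x - z))\<^sup>2"
  shows "armijo_step f \<sigma> \<rho> x d = 1"
proof -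
  define e where "e = norm (x - z)"
  have "f (x + d) - f z \<le> L / 2 * (norm (x + d - z))\<^sup>2"
    using upper[of "x + d" z] z by simp
  also have "\<dots> \<le> L / 2 * (\<epsilon> * e)\<^sup>2"
    using newton L_pos by (intro mult_left_mono power_mono) (auto simp: e_def)
  also have "\<dots> = (L / 2 * \<epsilon> * e\<^sup>2) * \<epsilon>" by (simp add: power2_eq_square)
  also have "\<dots> \<le> L / 2 * \<epsilon> * e\<^sup>2" using \<epsilon> L_pos by (intro mult_left_le) auto
  finally have 1: "f (x + d) - f z \<le> L / 2 * \<epsilon> * e\<^sup>2" .
  have "\<bar>g x \<bullet> (x + d - z)\<bar> \<le> norm (g x) * norm (x + d - z)" by (rule Cauchy_Schwarz_ineq2)
  also have "\<dots> \<le> (L * e) * (\<epsilon> * e)"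
    using norm_gradient_le[OF z, of x] newton L_pos unfolding e_def by (intro mult_mono) auto
  also have "\<dots> = L * \<epsilon> * e\<^sup>2" by (simp add: power2_eq_square)
  finally have 2: "\<bar>g x \<bullet> (x + d - z)\<bar> \<le> L * \<epsilon> * e\<^sup>2" .
  have 3: "\<bar>\<sigma> * (g x \<bullet> (x + d - z))\<bar> \<le> L / 2 * \<epsilon> * e\<^sup>2"
  proof -
    have "\<bar>\<sigma> * (g x \<bullet> (x + d - z))\<bar> = \<sigma> * \<bar>g x \<bullet> (x + d - z)\<bar>" using \<sigma> by (simp add: abs_mult)
    also have "\<dots> \<le> 1 / 2 * (L * \<epsilon> * e\<^sup>2)" using \<sigma> 2 by (intro mult_mono) auto
    finally show ?thesis by simp
  qed
  have gd: "g x \<bullet> d = g x \<bullet> (x + d - z) - g x \<bullet> (x - z)" by (simp add: inner_diff inner_add)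
  have "m * e\<^sup>2 \<le> g x \<bullet> (x - z)" using monotone[of x z] z by (simp add: e_def)
  then have "(1 / 2 - \<sigma>) * (m * e\<^sup>2) \<le> (1 / 2 - \<sigma>) * (g x \<bullet> (x - z))" using \<sigma> by simp
  moreover have "(L + 1) * (\<epsilon> + \<epsilon>) * e\<^sup>2 \<le> (1 / 2 - \<sigma>) * m * e\<^sup>2"
    using \<epsilon>(3) by (rule mult_right_mono) simp
  ultimately have 4: "(L + 1) * (\<epsilon> + \<epsilon>) * e\<^sup>2 \<le> (1 / 2 - \<sigma>) * (g x \<bullet> (x - z))" by simp
  \<comment> \<open>The errors sum to at most \<open>(L + 1) * \<epsilon> * e\<^sup>2\<close>: a
    share \<open>L / 2\<close> each from the cost at the new point and from
    \<open>\<sigma> * Q\<close>, and a share 1 from the trapezoidal rule.\<close>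
  define P Q where "P = g x \<bullet> (x - z)" and "Q = g x \<bullet> (x + d - z)"
  have "0 \<le> \<epsilon> * e\<^sup>2" "0 \<le> L * (\<epsilon> * e\<^sup>2)" using \<epsilon> L_pos by auto
  with 1 3 4 trapezoid have "f (x + d) \<le> f x + \<sigma> * (Q - P)"
    unfolding e_def[symmetric] P_def[symmetric] Q_def[symmetric] abs_le_iff
    by (simp add: algebra_simps)
  then have "f (x + d) \<le> f x + \<sigma> * (g x \<bullet> d)" by (simp add: gd P_def Q_def)
  then have ex: "f (x + \<rho> ^ 0 *\<^sub>R d) \<le> f x + \<sigma> * \<rho> ^ 0 * (g x \<bullet> d)" by simp
  show ?thesis
    by (rule armijo_stepE[OF \<rho> deriv_along ex]) simp
qed

text \<open>Near \<open>z\<close> full steps are accepted, so the tail of the sequence follows the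
  pure Newton map. Little-o along \<open>nhds z\<close> includes the point \<open>z\<close> itself
  and so covers iterates that hit the minimizer.\<close>

lemma superlinear_convergence:
  assumes \<sigma>: "0 < \<sigma>" "\<sigma> < 1 / 2" and \<rho>: "0 < \<rho>" "\<rho> < 1" and z: "g z = 0"
    and lim: "H \<longlonglongrightarrow> z"
    and step: "\<And>n. H (Suc n) = H n + armijo_step f \<sigma> \<rho> (H n) (d (H n)) *\<^sub>R d (H n)"
    and newton: "(\<lambda>x. norm (x + d x - z)) \<in> o[nhds z](\<lambda>x. norm (x - z))"
    and trapezoid: "(\<lambda>x. f x - f z - g x \<bullet> (x - z) / 2) \<in> o[nhds z](\<lambda>x. (norm (x - z))\<^sup>2)"
  shows "(\<lambda>n. norm (H (Suc n) - z)) \<in> o(\<lambda>n. norm (H n - z))"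
proof -
  define \<epsilon> where "\<epsilon> = min 1 ((1 / 2 - \<sigma>) * m / (2 * (L + 1)))"
  have \<epsilon>: "0 < \<epsilon>" "\<epsilon> \<le> 1" using \<sigma> m_pos L_pos by (auto simp: \<epsilon>_def)
  have "\<epsilon> \<le> (1 / 2 - \<sigma>) * m / (2 * (L + 1))" by (simp add: \<epsilon>_def)
  then have \<epsilon>': "(L + 1) * (\<epsilon> + \<epsilon>) \<le> (1 / 2 - \<sigma>) * m" using L_pos by (simp add: field_simps)
  have ev: "\<forall>\<^sub>F x in nhds z. armijo_step f \<sigma> \<rho> x (d x) = 1"
    using landau_o.smallD[OF newton \<epsilon>(1)] landau_o.smallD[OF trapezoid \<epsilon>(1)]
    by eventually_elim (rule newton_step[OF \<sigma> \<rho> z \<epsilon> \<epsilon>']; simp)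
  have "(\<lambda>n. norm (H n + d (H n) - z)) \<in> o(\<lambda>n. norm (H n - z))"
    using landau_o.small.compose[OF newton lim] by simp
  moreover have "\<forall>\<^sub>F n in sequentially. norm (H (Suc n) - z) = norm (H n + d (H n) - z)"
    using eventually_compose_filterlim[OF ev lim] by eventually_elim (simp add: step)
  ultimately show ?thesis by (subst landau_o.small.in_cong)
qed

end

section \<open>Symmetric matrices\<close>

lemma transpose_eq_iff:
  fixes A :: "real^'n^'n"
  shows "transpose A = A \<longleftrightarrow> (\<forall>x y. x \<bullet> (A *v y) = (A *v x) \<bullet> y)"
proof
  assume "transpose A = A"
  then show "\<forall>x y. x \<bullet> (A *v y) = (A *v x) \<bullet> y"
    by (metis dot_lmul_matrix transpose_matrix_vector)
next
  assume *: "\<forall>x y. x \<bullet> (A *v y) = (A *v x) \<bullet> y"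
  have "transpose A *v x = A *v x" for x
    by (rule vector_eq_ldot[THEN iffD1])
       (metis * dot_lmul_matrix transpose_matrix_vector inner_commute)
  then show "transpose A = A" by (simp add: matrix_eq)
qed

text \<open>The first-order condition at a minimum in one variable. The witness turns the expression
  into \<open>t\<^sup>2 * (c - 2 * \<bar>c\<bar> - 2)\<close>, negative unless \<open>t\<close>
  vanishes.\<close>

lemma quadratic_nonneg_imp_zero:
  fixes b c :: real
  assumes "\<And>t. 0 \<le> 2 * t * b + t\<^sup>2 * c"
  shows "b = 0"
proof -
  define t where "t = - b / (\<bar>c\<bar> + 1)"
  have b: "b = - t * (\<bar>c\<bar> + 1)" by (simp add: t_def)
  have "2 * t * b + t\<^sup>2 * c = t\<^sup>2 * (c - 2 * \<bar>c\<bar> - 2)"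
    by (subst b) (simp add: power2_eq_square algebra_simps)
  then have "0 \<le> t\<^sup>2 * (c - 2 * \<bar>c\<bar> - 2)" using assms[of t] by simp
  then have "t = 0" by (auto simp: zero_le_mult_iff)
  then show "b = 0" using b by simp
qed

text \<open>A minimum of the Rayleigh quotient is attained at an eigenvector.\<close>

lemma rayleigh_lower:
  fixes A :: "real^'n^'n"
  assumes sym: "transpose A = A" and ev: "\<And>l. eigenvalue A l \<Longrightarrow> a \<le> l"
  shows "a * (norm x)\<^sup>2 \<le> x \<bullet> (A *v x)"
proof -
  have sym': "x \<bullet> (A *v y) = (A *v x) \<bullet> y" for x y using sym transpose_eq_iff by blast
  have "continuous_on (sphere 0 1) (\<lambda>x. x \<bullet> (A *v x))"
    by (intro continuous_intros matrix_vector_mult_linear_continuous_on)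
  moreover have "sphere (0::real^'n) 1 \<noteq> {}" by simp
  ultimately obtain v :: "real^'n" where v: "norm v = 1"
    "\<And>y. norm y = 1 \<Longrightarrow> v \<bullet> (A *v v) \<le> y \<bullet> (A *v y)"
    using continuous_attains_inf[OF compact_sphere, of 0 1 "\<lambda>x. x \<bullet> (A *v x)"] by auto
  define l where "l = v \<bullet> (A *v v)"
  have l: "l * (norm y)\<^sup>2 \<le> y \<bullet> (A *v y)" for y
  proof (cases "y = 0")
    case False
    have "l \<le> (y /\<^sub>R norm y) \<bullet> (A *v (y /\<^sub>R norm y))"
      unfolding l_def by (rule v(2)) (use False in simp)
    also have "\<dots> = (y \<bullet> (A *v y)) / (norm y)\<^sup>2"
      by (simp add: matrix_vector_mult_scaleR power2_eq_square divide_inverse)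
    finally show ?thesis using False by (simp add: field_simps)
  qed simp
  \<comment> \<open>The residual of the eigenvalue equation. Moving the minimizer \<open>v\<close>
    in the direction \<open>r\<close> changes the shifted form with linear coefficient
    \<open>2 * (r \<bullet> r)\<close>, which therefore vanishes.\<close>
  define r where "r = A *v v - l *\<^sub>R v"
  have "r \<bullet> r = 0"
  proof (rule quadratic_nonneg_imp_zero)
    fix t
    have "0 \<le> (v + t *\<^sub>R r) \<bullet> (A *v (v + t *\<^sub>R r)) - l * (norm (v + t *\<^sub>R r))\<^sup>2"
      using l by simp
    also have "\<dots> = 2 * t * (r \<bullet> (A *v v) - l * (r \<bullet> v)) + t\<^sup>2 * (r \<bullet> (A *v r) - l * (r \<bullet> r))
        + (v \<bullet> (A *v v) - l * (v \<bullet> v))"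
      unfolding power2_norm_eq_inner using sym'[of v r]
      by (simp add: matrix_vector_right_distrib matrix_vector_mult_scaleR
          inner_add inner_commute power2_eq_square algebra_simps)
    also have "v \<bullet> (A *v v) - l * (v \<bullet> v) = 0"
      using v(1) by (simp add: l_def flip: power2_norm_eq_inner)
    also have "r \<bullet> (A *v v) - l * (r \<bullet> v) = r \<bullet> r"
      by (simp add: r_def inner_diff inner_commute algebra_simps)
    finally show "0 \<le> 2 * t * (r \<bullet> r) + t\<^sup>2 * (r \<bullet> (A *v r) - l * (r \<bullet> r))" by simp
  qed
  then have "A *v v = l *\<^sub>R v" by (simp add: r_def)
  moreover have "v \<noteq> 0" using v(1) by auto
  ultimately have "a \<le> l" by (intro ev) (auto simp: eigenvalue_def)
  then show ?thesis using l[of x] by (smt (verit) mult_right_mono zero_le_power2)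
qed

lemma rayleigh_upper:
  fixes A :: "real^'n^'n"
  assumes sym: "transpose A = A" and ev: "\<And>l. eigenvalue A l \<Longrightarrow> l \<le> b"
  shows "x \<bullet> (A *v x) \<le> b * (norm x)\<^sup>2"
proof -
  have neg: "(- A) *v x = - (A *v x)" for x
    by (simp add: matrix_vector_mult_def vec_eq_iff sum_negf)
  have "transpose (- A) = - A" using sym by (simp add: transpose_def vec_eq_iff)
  moreover have "- b \<le> l" if "eigenvalue (- A) l" for l
  proof -
    from that have "eigenvalue A (- l)" 
      by (auto simp: eigenvalue_def neg minus_equation_iff[of "A *v _"])
    from ev[OF this] show ?thesis by simp
  qed
  ultimately have "- b * (norm x)\<^sup>2 \<le> x \<bullet> ((- A) *v x)" by (rule rayleigh_lower)
  then show ?thesis by (simp add: neg)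
qed

text \<open>The form is nonnegative at \<open>b *\<^sub>R x - A *v x\<close>; this replaces a
  spectral decomposition. It bounds the length of a search direction by its descent.\<close>

lemma norm_matrix_vector_squared_le:
  fixes A :: "real^'n^'n"
  assumes sym: "transpose A = A" and b: "0 < b"
    and bounds: "\<And>x. 0 \<le> x \<bullet> (A *v x)" "\<And>x. x \<bullet> (A *v x) \<le> b * (norm x)\<^sup>2"
  shows "(norm (A *v x))\<^sup>2 \<le> b * (x \<bullet> (A *v x))"
proof -
  have sym': "x \<bullet> (A *v y) = (A *v x) \<bullet> y" for x y using sym transpose_eq_iff by blast
  define y where "y = A *v x"
  have "0 \<le> (b *\<^sub>R x - y) \<bullet> (A *v (b *\<^sub>R x - y))" by (rule bounds)
  also have "\<dots> = b\<^sup>2 * (x \<bullet> y) - 2 * b * (norm y)\<^sup>2 + y \<bullet> (A *v y)"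
    unfolding power2_norm_eq_inner using sym'[of x y]
    by (simp add: y_def matrix_vector_mult_diff_distrib matrix_vector_mult_scaleR
        inner_diff power2_eq_square inner_commute algebra_simps)
  also have "\<dots> \<le> b\<^sup>2 * (x \<bullet> y) - b * (norm y)\<^sup>2" using bounds(2)[of y] by simp
  also have "\<dots> = b * (b * (x \<bullet> y) - (norm y)\<^sup>2)" by (simp add: power2_eq_square algebra_simps)
  finally show ?thesis using b by (simp add: zero_le_mult_iff y_def)
qed

section \<open>Inverses of coercive symmetric matrices\<close>

context
  fixes A :: "real^'n^'n" and a :: real
  assumes sym: "transpose A = A" and a_pos: "0 < a"
    and coercive: "\<And>x. a * (norm x)\<^sup>2 \<le> x \<bullet> (A *v x)"
begin

lemma coercive_invertible: "invertible A"
proof -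
  have "x = 0" if "A *v x = 0" for x
    using coercive[of x] that a_pos by (simp add: mult_le_0_iff)
  then show ?thesis by (simp add: invertible_left_inverse matrix_left_invertible_ker)
qed

lemma coercive_inv:
  shows "A *v (matrix_inv A *v x) = x" and "matrix_inv A *v (A *v x) = x"
proof -
  have "A ** matrix_inv A = mat 1 \<and> matrix_inv A ** A = mat 1"
    unfolding matrix_inv_def using coercive_invertible[unfolded invertible_def] by (rule someI_ex)
  then show "A *v (matrix_inv A *v x) = x" and "matrix_inv A *v (A *v x) = x"
    by (simp_all add: matrix_vector_mul_assoc)
qed

lemma coercive_inv_sym: "transpose (matrix_inv A) = matrix_inv A"
  unfolding transpose_eq_iff
proof (intro allI)
  fix x y
  have "x \<bullet> (matrix_inv A *v y) = (A *v (matrix_inv A *v x)) \<bullet> (matrix_inv A *v y)"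
    by (simp add: coercive_inv)
  also have "\<dots> = (matrix_inv A *v x) \<bullet> (A *v (matrix_inv A *v y))"
    using sym transpose_eq_iff by metis
  finally show "x \<bullet> (matrix_inv A *v y) = (matrix_inv A *v x) \<bullet> y"
    by (simp add: coercive_inv)
qed

lemma coercive_inv_lower: "a * (norm (matrix_inv A *v x))\<^sup>2 \<le> x \<bullet> (matrix_inv A *v x)"
  using coercive[of "matrix_inv A *v x"] by (simp add: coercive_inv inner_commute)

lemma coercive_inv_norm: "norm (matrix_inv A *v x) \<le> norm x / a"
proof (cases "matrix_inv A *v x = 0")
  case False
  have "a * (norm (matrix_inv A *v x))\<^sup>2 \<le> norm x * norm (matrix_inv A *v x)"
    using coercive_inv_lower norm_cauchy_schwarz order_trans by blast
  then show ?thesis using False a_pos by (simp add: field_simps power2_eq_square)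
qed (use a_pos in simp)

lemma coercive_inv_nonneg: "0 \<le> x \<bullet> (matrix_inv A *v x)"
  using coercive_inv_lower[of x] a_pos by (smt (verit) mult_nonneg_nonneg zero_le_power2)

lemma coercive_inv_upper: "x \<bullet> (matrix_inv A *v x) \<le> (norm x)\<^sup>2 / a"
proof -
  have "x \<bullet> (matrix_inv A *v x) \<le> norm x * norm (matrix_inv A *v x)"
    by (rule norm_cauchy_schwarz)
  also have "\<dots> \<le> norm x * (norm x / a)"
    by (intro mult_left_mono coercive_inv_norm) simp
  finally show ?thesis by (simp add: power2_eq_square)
qed

lemma coercive_inv_sym_pos_def: "sym_pos_def (matrix_inv A)"
  unfolding sym_pos_def_def
proof (intro conjI allI impI coercive_inv_sym)
  fix x :: "real^'n" assume "x \<noteq> 0"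
  then have "matrix_inv A *v x \<noteq> 0" using coercive_inv(1)[of x] by auto
  then have "0 < a * (norm (matrix_inv A *v x))\<^sup>2" using a_pos by simp
  then show "0 < x \<bullet> (matrix_inv A *v x)" using coercive_inv_lower[of x] by linarith
qed

text \<open>An eigenvector satisfies \<open>(norm v)\<^sup>2 = l * (v \<bullet> (A *v v))\<close>,
  and the bounds on the form bracket \<open>l\<close>. This brings the inverse generalized Jacobians
  under the linear convergence result.\<close>

lemma coercive_inv_eigenvalue:
  assumes upper: "\<And>x. x \<bullet> (A *v x) \<le> b * (norm x)\<^sup>2" and l: "eigenvalue (matrix_inv A) l"
  shows "1 / b \<le> l" "l \<le> 1 / a"
proof -
  obtain v where v: "v \<noteq> 0" "matrix_inv A *v v = l *\<^sub>R v" using l by (auto simp: eigenvalue_def)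
  have "v = A *v (l *\<^sub>R v)" using coercive_inv(1)[of v] v by simp
  then have "v \<bullet> v = l * (v \<bullet> (A *v v))"
    by (metis inner_scaleR_right matrix_vector_mult_scaleR)
  then have eq: "(norm v)\<^sup>2 = l * (v \<bullet> (A *v v))" by (simp add: power2_norm_eq_inner)
  have v_pos: "0 < (norm v)\<^sup>2" using v by simp
  have pos: "0 < v \<bullet> (A *v v)" using coercive[of v] v_pos a_pos
    by (smt (verit) mult_pos_pos)
  then have "0 < l" using eq v_pos by (simp add: zero_less_mult_iff)
  have "0 < b * (norm v)\<^sup>2" using pos upper[of v] by linarith
  then have "0 < b" using v_pos by (simp add: zero_less_mult_iff)
  have "(norm v)\<^sup>2 \<le> l * (b * (norm v)\<^sup>2)" unfolding eq[symmetric]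
    using eq upper[of v] \<open>0 < l\<close> by (metis mult_left_mono less_imp_le)
  then have "1 * (norm v)\<^sup>2 \<le> (l * b) * (norm v)\<^sup>2" by simp
  then have "1 \<le> l * b" using v_pos by (rule mult_right_le_imp_le)
  then show "1 / b \<le> l" using \<open>0 < b\<close> by (simp add: field_simps)
  have "l * (a * (norm v)\<^sup>2) \<le> (norm v)\<^sup>2"
    using eq coercive[of v] \<open>0 < l\<close> by (metis mult_left_mono less_imp_le)
  then have "(l * a) * (norm v)\<^sup>2 \<le> 1 * (norm v)\<^sup>2" by simp
  then have "l * a \<le> 1" using v_pos by (rule mult_right_le_imp_le)
  then show "l \<le> 1 / a" using a_pos by (simp add: field_simps)
qed

end

section \<open>Expansions of radial fields\<close>

lemma isCont_nhds: "isCont f x \<Longrightarrow> (f \<longlongrightarrow> f x) (nhds x)"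
  by (simp add: isCont_def flip: tendsto_at_iff_tendsto_nhds)

lemma isCont_imp_bigo_1:
  fixes f :: "'a::t2_space \<Rightarrow> real"
  assumes "isCont f x" shows "f \<in> O[nhds x](\<lambda>_. 1)"
  using bigoI_tendsto[of f "\<lambda>_. 1" "f x" "nhds x"] isCont_nhds[OF assms] by simp

lemma isCont_imp_smallo_1:
  fixes f :: "'a::t2_space \<Rightarrow> real"
  assumes "isCont f x" "f x = 0" shows "f \<in> o[nhds x](\<lambda>_. 1)"
  using smalloI_tendsto[of f "\<lambda>_. 1" "nhds x"] isCont_nhds[OF assms(1)] assms(2) by simp

text \<open>Taylor expansion about the moving point: the derivative is taken at \<open>x\<close>, not at \<open>a\<close>.\<close>

lemma strict_derivative_smallo:
  fixes p p' :: "real \<Rightarrow> real"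
  assumes deriv: "\<forall>\<^sub>F x in nhds a. (p has_real_derivative p' x) (at x)"
    and cont: "isCont p' a"
  shows "(\<lambda>x. p x - p a - p' x * (x - a)) \<in> o[nhds a](\<lambda>x. x - a)"
proof (rule landau_o.smallI)
  fix c :: real assume "c > 0"
  then have "\<forall>\<^sub>F x in nhds a. \<bar>p' x - p' a\<bar> < c / 2"
    using tendstoD[OF isCont_nhds[OF cont], of "c / 2"] by (simp add: dist_real_def)
  with deriv have "\<forall>\<^sub>F x in nhds a. (p has_real_derivative p' x) (at x) \<and> \<bar>p' x - p' a\<bar> < c / 2"
    by eventually_elim simp
  then obtain d where d: "d > 0" "\<And>x. dist x a < d \<Longrightarrow> (p has_real_derivative p' x) (at x)"
    "\<And>x. dist x a < d \<Longrightarrow> \<bar>p' x - p' a\<bar> < c / 2"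
    unfolding eventually_nhds_metric by blast
  have "\<bar>p x - p a - p' x * (x - a)\<bar> \<le> c * \<bar>x - a\<bar>" if x: "dist x a < d" for x
  proof -
    have deriv': "((\<lambda>t. p t - p' x * t) has_derivative (\<lambda>h. (p' t - p' x) * h)) (at t within closed_segment a x)"
      if "t \<in> closed_segment a x" for t
    proof -
      have "dist t a < d" using that x by (auto simp: dist_real_def closed_segment_eq_real_ivl split: if_splits)
      from d(2)[OF this] have "((\<lambda>t. p t - p' x * t) has_real_derivative p' t - p' x) (at t)"
        by (auto intro!: derivative_eq_intros)
      then show ?thesis by (simp add: has_field_derivative_def has_derivative_at_withinI)
    qed
    \<comment> \<open>Mean value inequality for \<open>p\<close> with the slope at \<open>x\<close>
      removed: \<open>p' t\<close> and \<open>p' x\<close> are both within \<open>c / 2\<close> of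
      \<open>p' a\<close>.\<close>
    have "norm ((p x - p' x * x) - (p a - p' x * a)) \<le> c * norm (x - a)"
    proof (rule differentiable_bound[OF convex_closed_segment deriv'])
      fix t assume "t \<in> closed_segment a x"
      then have "dist t a < d" using x
        by (auto simp: dist_real_def closed_segment_eq_real_ivl split: if_splits)
      then have "\<bar>p' t - p' x\<bar> \<le> c" using d(3)[of t] d(3)[OF x] by linarith
      then show "onorm (\<lambda>h. (p' t - p' x) * h) \<le> c"
        by (intro onorm_bound) (auto simp: abs_mult mult_right_mono)
    qed auto
    then show ?thesis by (simp add: algebra_simps)
  qed
  with d(1) show "\<forall>\<^sub>F x in nhds a. norm (p x - p a - p' x * (x - a)) \<le> c * norm (x - a)"
    unfolding eventually_nhds_metric by (metis real_norm_def)
qed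

lemma norm_sgn_diff_le:
  fixes x y :: "'a::real_inner"
  assumes "y \<noteq> 0"
  shows "norm (sgn x - sgn y) \<le> 2 / norm y * norm (x - y)"
proof (cases "x = 0")
  case True
  then show ?thesis using assms by (simp add: norm_sgn)
next
  case False
  have "norm y *\<^sub>R (sgn x - sgn y) = (norm y - norm x) *\<^sub>R sgn x + (x - y)"
    using False assms by (simp add: sgn_div_norm algebra_simps)
  then have "norm y * norm (sgn x - sgn y) = norm ((norm y - norm x) *\<^sub>R sgn x + (x - y))"
    by (metis abs_norm_cancel norm_scaleR)
  also have "\<dots> \<le> \<bar>norm y - norm x\<bar> * 1 + norm (x - y)"
    using False by (intro order_trans[OF norm_triangle_ineq]) (simp add: norm_sgn)
  also have "\<dots> \<le> 2 * norm (x - y)"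
    using norm_triangle_ineq3[of x y] by simp
  finally show ?thesis using assms by (simp add: field_simps)
qed

lemma inner_unit_vectors:
  assumes "norm u = 1" "norm v = 1"
  shows "u \<bullet> v = 1 - (norm (u - v))\<^sup>2 / 2"
proof -
  have "u \<bullet> u = 1" "v \<bullet> v = 1" using assms by (simp_all flip: power2_norm_eq_inner)
  then show ?thesis
    by (simp add: power2_norm_eq_inner inner_diff inner_commute[of v u] diff_divide_distrib)
qed

lemma inner_sgn_self: "sgn x \<bullet> x = norm x" for x :: "'a::real_inner"
  by (cases "x = 0") (simp_all add: sgn_div_norm power2_eq_square flip: power2_norm_eq_inner)

lemma inner_sgn_squared_le: "(sgn x \<bullet> v)\<^sup>2 \<le> (norm v)\<^sup>2" for x v :: "'a::real_inner"
proof -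
  have "\<bar>sgn x \<bullet> v\<bar> \<le> norm (sgn x) * norm v" by (rule Cauchy_Schwarz_ineq2)
  also have "\<dots> \<le> 1 * norm v" by (intro mult_right_mono) (auto simp: norm_sgn)
  finally show ?thesis by (simp flip: abs_le_square_iff)
qed

definition radial_slope :: "(real \<Rightarrow> real) \<Rightarrow> (real \<Rightarrow> real) \<Rightarrow> real \<Rightarrow> real" where
  "radial_slope p p' r = (if r = 0 then p' 0 else p r / r)"

text \<open>
  For the field \<open>p (norm x) *\<^sub>R sgn x\<close>, the slope \<open>p r / r\<close> acts on tangential directions and
  \<open>p' r\<close> on the radial one.
\<close>

definition radial_deriv ::
  "(real \<Rightarrow> real) \<Rightarrow> (real \<Rightarrow> real) \<Rightarrow> 'a::real_inner \<Rightarrow> 'a \<Rightarrow> 'a" where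
  "radial_deriv p p' x v = radial_slope p p' (norm x) *\<^sub>R v
    + ((p' (norm x) - radial_slope p p' (norm x)) * (sgn x \<bullet> v)) *\<^sub>R sgn x"

lemma inner_radial_deriv:
  "v \<bullet> radial_deriv p p' x w = radial_slope p p' (norm x) * (v \<bullet> w)
    + (p' (norm x) - radial_slope p p' (norm x)) * (sgn x \<bullet> w) * (sgn x \<bullet> v)"
  by (simp add: radial_deriv_def inner_add inner_commute)

lemma radial_field_has_derivative:
  fixes x :: "'a::real_inner"
  assumes "(p has_real_derivative p' (norm x)) (at (norm x))" and "x = 0 \<Longrightarrow> p 0 = 0"
  shows "((\<lambda>x. p (norm x) *\<^sub>R sgn x) has_derivative radial_deriv p p' x) (at x)"
proof (cases "x = 0")
  case True
  show ?thesis unfolding True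
  proof (rule has_derivativeI)
    have "radial_deriv p p' (0::'a) = (\<lambda>v. p' 0 *\<^sub>R v)"
      by (simp add: radial_deriv_def radial_slope_def fun_eq_iff)
    then show "bounded_linear (radial_deriv p p' (0::'a))"
      by (simp add: bounded_linear_scaleR_right)
    have "(p has_real_derivative p' 0) (at 0)" using assms(1) True by simp
    then have "((\<lambda>h. (p h - p 0) / h) \<longlongrightarrow> p' 0) (at 0)" by (simp add: DERIV_def)
    moreover have "filterlim (\<lambda>y::'a. norm y) (at 0) (at 0)"
      by (auto simp: filterlim_at tendsto_norm_zero eventually_at_filter)
    ultimately have "((\<lambda>y::'a. p (norm y) / norm y) \<longlongrightarrow> p' 0) (at 0)"
      using assms(2) True by (auto dest: filterlim_compose)
    then have "((\<lambda>y::'a. p (norm y) / norm y - p' 0) \<longlongrightarrow> p' 0 - p' 0) (at 0)"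
      by (intro tendsto_intros)
    then have lim: "((\<lambda>y::'a. p (norm y) / norm y - p' 0) \<longlongrightarrow> 0) (at 0)" by simp
    have lim': "((\<lambda>y::'a. \<bar>p (norm y) / norm y - p' 0\<bar>) \<longlongrightarrow> 0) (at 0)"
      using lim by (rule tendsto_rabs_zero)
    have eq: "norm ((p (norm y) *\<^sub>R sgn y - p (norm (0::'a)) *\<^sub>R sgn 0
          - radial_deriv p p' 0 (y - 0)) /\<^sub>R norm (y - 0)) = \<bar>p (norm y) / norm y - p' 0\<bar>"
      if "y \<noteq> 0" for y :: 'a
    proof -
      have "p (norm y) *\<^sub>R sgn y - p (norm (0::'a)) *\<^sub>R sgn 0 - radial_deriv p p' 0 (y - 0)
        = (p (norm y) / norm y - p' 0) *\<^sub>R y"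
        using that by (simp add: radial_deriv_def radial_slope_def sgn_div_norm divide_inverse
            algebra_simps)
      then show ?thesis using that by (simp add: abs_mult)
    qed
    show "((\<lambda>y::'a. (p (norm y) *\<^sub>R sgn y - p (norm (0::'a)) *\<^sub>R sgn 0
          - radial_deriv p p' 0 (y - 0)) /\<^sub>R norm (y - 0)) \<longlongrightarrow> 0) (at 0)"
      by (rule Lim_null_comparison[OF _ lim']) (use eq in \<open>simp add: eventually_at_filter\<close>)
  qed
next
  case False
  note der = has_derivative_norm[OF False]
  have "((\<lambda>x. p (norm x)) has_derivative (\<lambda>v. p' (norm x) * (v \<bullet> sgn x))) (at x)"
    using has_derivative_compose[OF der assms(1)[unfolded has_field_derivative_def]] by simp
  moreover have "((\<lambda>x. inverse (norm x)) has_derivative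
      (\<lambda>v. - (inverse (norm x) * (v \<bullet> sgn x) * inverse (norm x)))) (at x)"
    by (rule Deriv.has_derivative_inverse[OF _ der]) (use False in simp)
  ultimately have "((\<lambda>y. (p (norm y) * inverse (norm y)) *\<^sub>R y) has_derivative
      (\<lambda>v. (p (norm x) * inverse (norm x)) *\<^sub>R v
        + (p (norm x) * - (inverse (norm x) * (v \<bullet> sgn x) * inverse (norm x))
           + p' (norm x) * (v \<bullet> sgn x) * inverse (norm x)) *\<^sub>R x)) (at x)"
    by (intro has_derivative_scaleR has_derivative_mult has_derivative_ident)
  also have "(\<lambda>v. (p (norm x) * inverse (norm x)) *\<^sub>R v
        + (p (norm x) * - (inverse (norm x) * (v \<bullet> sgn x) * inverse (norm x))
           + p' (norm x) * (v \<bullet> sgn x) * inverse (norm x)) *\<^sub>R x) = radial_deriv p p' x"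
    using False
    by (auto simp: radial_deriv_def radial_slope_def sgn_div_norm fun_eq_iff inner_commute
        field_simps)
  finally show ?thesis by (simp add: sgn_div_norm)
qed

text \<open>A displacement from the origin is radial and leaves only the scalar remainder
  \<open>s\<close>. Elsewhere the error splits into \<open>s\<close>, a term quadratic in the change
  of direction, and a term linear in it with a vanishing factor \<open>B\<close>. The result serves
  the force law and, with constant \<open>p\<close>, the pinning term.\<close>

lemma radial_field_strict_derivative:
  fixes y :: "'a::real_inner"
  assumes deriv: "\<forall>\<^sub>F r in nhds (norm y). (p has_real_derivative p' r) (at r)"
    and cont: "isCont p' (norm y)" and zero: "y = 0 \<Longrightarrow> p 0 = 0"
  shows "(\<lambda>x. norm (p (norm x) *\<^sub>R sgn x - p (norm y) *\<^sub>R sgn y - radial_deriv p p' x (x - y)))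
    \<in> o[nhds y](\<lambda>x. norm (x - y))"
proof -
  define s where "s r = p r - p (norm y) - p' r * (r - norm y)" for r
  have lim_norm: "filterlim norm (nhds (norm y)) (nhds y)"
    by (rule isCont_nhds) (intro continuous_intros)
  have "s \<in> o[nhds (norm y)](\<lambda>r. r - norm y)"
    unfolding s_def by (rule strict_derivative_smallo[OF deriv cont])
  from landau_o.small.compose[OF this lim_norm]
  have "(\<lambda>x. s (norm x)) \<in> o[nhds y](\<lambda>x. norm x - norm y)" .
  moreover have "(\<lambda>x. norm x - norm y) \<in> O[nhds y](\<lambda>x. norm (x - y))"
    by (intro bigoI[of _ 1] eventuallyI) (simp add: norm_triangle_ineq3)
  ultimately have s: "(\<lambda>x. s (norm x)) \<in> o[nhds y](\<lambda>x. norm (x - y))"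
    by (rule landau_o.small_big_trans)
  show ?thesis
  proof (cases "y = 0")
    case True
    have "norm (p (norm x) *\<^sub>R sgn x - p (norm y) *\<^sub>R sgn y - radial_deriv p p' x (x - y))
      = norm (s (norm x))" for x
    proof (cases "x = 0")
      case False
      then have "sgn x \<bullet> x = norm x" "(p (norm x) / norm x) *\<^sub>R x = p (norm x) *\<^sub>R sgn x"
        "(p' (norm x) - p (norm x) / norm x) * norm x = p' (norm x) * norm x - p (norm x)"
        by (simp_all add: sgn_div_norm power2_norm_eq_inner[symmetric] power2_eq_square
            divide_inverse left_diff_distrib)
      then have "p (norm x) *\<^sub>R sgn x - radial_deriv p p' x x = (p (norm x) - p' (norm x) * norm x) *\<^sub>R sgn x"
        using False by (simp add: radial_deriv_def radial_slope_def left_diff_distrib scaleR_diff_left)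
      then show ?thesis using True False zero by (simp add: s_def norm_sgn)
    qed (use True in \<open>simp add: radial_deriv_def s_def\<close>)
    then show ?thesis using s by simp
  next
    case False
    let ?u = "\<lambda>x. norm (sgn x - sgn y)"
    define A where "A x = \<bar>p' (norm x)\<bar> * norm y + \<bar>p (norm x) * norm y / norm x\<bar>" for x :: 'a
    define B where "B x = \<bar>p (norm y) - p (norm x) * norm y / norm x\<bar>" for x :: 'a
    have "isCont p (norm y)" using deriv[THEN eventually_nhds_x_imp_x] DERIV_isCont by blast
    then have "isCont (\<lambda>x. p (norm x)) y" "isCont (\<lambda>x. p' (norm x)) y"
      using cont by (auto intro!: isCont_o2[of y norm] continuous_intros)
    then have "isCont A y" "isCont B y"
      unfolding A_def B_def using False by (auto intro!: continuous_intros)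
    then have A: "A \<in> O[nhds y](\<lambda>_. 1)" and B: "B \<in> o[nhds y](\<lambda>_. 1)"
      using isCont_imp_bigo_1 isCont_imp_smallo_1[of y B] False by (auto simp: B_def)
    have u: "?u \<in> O[nhds y](\<lambda>x. norm (x - y))"
      using norm_sgn_diff_le[OF False] by (intro bigoI[of _ "2 / norm y"] eventuallyI) simp
    have u1: "?u \<in> o[nhds y](\<lambda>_. 1)"
      using False by (intro isCont_imp_smallo_1) (auto intro!: continuous_intros)
    have "(\<lambda>x. A x * (?u x * ?u x)) \<in> o[nhds y](\<lambda>x. 1 * (norm (x - y) * 1))"
      by (intro landau_o.mult A u u1)
    moreover have "(\<lambda>x. B x * ?u x) \<in> o[nhds y](\<lambda>x. 1 * norm (x - y))"
      by (intro landau_o.mult B u)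
    ultimately have bound: "(\<lambda>x. \<bar>s (norm x)\<bar> + A x * (?u x * ?u x) + B x * ?u x) \<in> o[nhds y](\<lambda>x. norm (x - y))"
      using s by (intro sum_in_smallo) auto
    have le: "norm (p (norm x) *\<^sub>R sgn x - p (norm y) *\<^sub>R sgn y - radial_deriv p p' x (x - y))
      \<le> \<bar>s (norm x)\<bar> + A x * (?u x * ?u x) + B x * ?u x" if "x \<noteq> 0" for x
    proof -
      \<comment> \<open>One minus the cosine of the angle between \<open>x\<close> and
        \<open>y\<close>, which is half the squared chord \<open>?u x\<close>; hence the quadratic
        order in the direction.\<close>
      define c where "c = 1 - sgn x \<bullet> sgn y"
      define w where "w = p (norm x) * norm y / norm x"
      have c: "0 \<le> c" "c \<le> ?u x * ?u x"
        using that False inner_unit_vectors[of "sgn x" "sgn y"]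
        by (auto simp: c_def norm_sgn power2_eq_square)
      have x: "x = norm x *\<^sub>R sgn x" and y: "y = norm y *\<^sub>R sgn y"
        using that False by (simp_all add: sgn_div_norm)
      have uu: "sgn x \<bullet> sgn x = 1" using that by (simp add: norm_sgn flip: power2_norm_eq_inner)
      have "sgn x \<bullet> (x - y) = norm x * (sgn x \<bullet> sgn x) - norm y * (sgn x \<bullet> sgn y)"
        by (metis x y inner_diff_right inner_scaleR_right)
      then have ip: "sgn x \<bullet> (x - y) = norm x - norm y + norm y * c"
        unfolding uu by (simp add: c_def algebra_simps)
      have slope: "(p (norm x) / norm x) *\<^sub>R (x - y) = p (norm x) *\<^sub>R sgn x - w *\<^sub>R sgn y"
        using that False by (simp add: w_def sgn_div_norm scaleR_diff_right divide_inverse)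
      have w: "p (norm x) / norm x * (norm x - norm y + norm y * c) = p (norm x) - w * (1 - c)"
        using that by (simp add: w_def field_simps)
      have "radial_deriv p p' x (x - y) = p (norm x) *\<^sub>R sgn x - w *\<^sub>R sgn y
        + (p' (norm x) * (norm x - norm y + norm y * c) - (p (norm x) - w * (1 - c))) *\<^sub>R sgn x"
        unfolding radial_deriv_def radial_slope_def ip
        using that slope w by (simp add: left_diff_distrib)
      then have "p (norm x) *\<^sub>R sgn x - p (norm y) *\<^sub>R sgn y - radial_deriv p p' x (x - y)
        = s (norm x) *\<^sub>R sgn x + ((w - p' (norm x) * norm y) * c) *\<^sub>R sgn x
          + (p (norm y) - w) *\<^sub>R (sgn x - sgn y)"
        by (simp add: s_def algebra_simps)
      also have "norm \<dots> \<le> norm (s (norm x) *\<^sub>R sgn x)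
        + norm (((w - p' (norm x) * norm y) * c) *\<^sub>R sgn x) + norm ((p (norm y) - w) *\<^sub>R (sgn x - sgn y))"
        by (meson norm_triangle_ineq order_trans add_mono order_refl)
      also have "\<dots> = \<bar>s (norm x)\<bar> + \<bar>w - p' (norm x) * norm y\<bar> * c + B x * ?u x"
        using that c(1) by (simp add: norm_sgn abs_mult B_def w_def)
      also have "\<bar>w - p' (norm x) * norm y\<bar> * c \<le> A x * (?u x * ?u x)"
        using c by (intro mult_mono) (auto simp: A_def w_def abs_mult intro!: order_trans[OF abs_triangle_ineq4])
      finally show ?thesis by simp
    qed
    have "\<forall>\<^sub>F x in nhds y. x \<noteq> 0" using False by (rule t1_space_nhds)
    then have "\<forall>\<^sub>F x in nhds y. norm (norm (p (norm x) *\<^sub>R sgn x - p (norm y) *\<^sub>R sgn y - radial_deriv p p' x (x - y)))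
      \<le> 1 * norm (\<bar>s (norm x)\<bar> + A x * (?u x * ?u x) + B x * ?u x)"
      by eventually_elim (use le in \<open>force intro: order_trans[OF _ abs_ge_self]\<close>)
    then show ?thesis by (rule landau_o.big_small_trans[OF bigoI bound])
  qed
qed

text \<open>Along the segment the derivative of the trapezoidal defect is half the pairing of
  \<open>e\<close> with the strict remainder at \<open>y + t *\<^sub>R e\<close>, so the mean value
  inequality integrates the strict expansion.\<close>

lemma trapezoid_smallo:
  fixes f :: "'a::real_inner \<Rightarrow> real"
  assumes f: "\<forall>\<^sub>F x in nhds y. GDERIV f x :> F x"
    and F: "\<forall>\<^sub>F x in nhds y. (F has_derivative F' x) (at x)"
    and strict: "(\<lambda>x. norm (F x - F y - F' x (x - y))) \<in> o[nhds y](\<lambda>x. norm (x - y))"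
  shows "(\<lambda>x. f x - f y - (F x + F y) \<bullet> (x - y) / 2) \<in> o[nhds y](\<lambda>x. (norm (x - y))\<^sup>2)"
proof (rule landau_o.smallI)
  fix c :: real assume "c > 0"
  from f F landau_o.smallD[OF strict this]
  have "\<forall>\<^sub>F x in nhds y. GDERIV f x :> F x \<and> (F has_derivative F' x) (at x)
    \<and> norm (F x - F y - F' x (x - y)) \<le> c * norm (x - y)"
    by eventually_elim simp
  then obtain \<delta> where \<delta>: "\<delta> > 0" "\<And>x. dist x y < \<delta> \<Longrightarrow> GDERIV f x :> F x"
    "\<And>x. dist x y < \<delta> \<Longrightarrow> (F has_derivative F' x) (at x)"
    "\<And>x. dist x y < \<delta> \<Longrightarrow> norm (F x - F y - F' x (x - y)) \<le> c * norm (x - y)"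
    unfolding eventually_nhds_metric by blast
  have "\<bar>f x - f y - (F x + F y) \<bullet> (x - y) / 2\<bar> \<le> c * (norm (x - y))\<^sup>2" if x: "dist x y < \<delta>" for x
  proof -
    define e where "e = x - y"
    define k where "k t = f (y + t *\<^sub>R e) - t / 2 * ((F (y + t *\<^sub>R e) + F y) \<bullet> e)" for t
    define k' where "k' t = ((F (y + t *\<^sub>R e) - F y) \<bullet> e - t * (F' (y + t *\<^sub>R e) e \<bullet> e)) / 2" for t
    have near: "dist (y + t *\<^sub>R e) y < \<delta>" if "t \<in> {0..1}" for t
    proof -
      have "dist (y + t *\<^sub>R e) y = t * norm e" using that by (simp add: dist_norm)
      also have "\<dots> \<le> 1 * norm e" using that by (intro mult_right_mono) auto
      finally show ?thesis using x by (simp add: dist_norm e_def)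
    qed
    have lin: "F' (y + t *\<^sub>R e) (s *\<^sub>R e) = s *\<^sub>R F' (y + t *\<^sub>R e) e" if "t \<in> {0..1}" for s t
      using \<delta>(3)[OF near[OF that]] by (intro linear_cmul has_derivative_linear)
    have der: "(k has_derivative (\<lambda>h. k' t * h)) (at t within {0..1})" if t: "t \<in> {0..1}" for t
    proof -
      have line: "((\<lambda>t. y + t *\<^sub>R e) has_derivative (\<lambda>h. h *\<^sub>R e)) (at t)"
        by (auto intro!: derivative_eq_intros)
      have "((\<lambda>t. f (y + t *\<^sub>R e)) has_derivative (\<lambda>h. (h *\<^sub>R e) \<bullet> F (y + t *\<^sub>R e))) (at t)"
        using has_derivative_compose[OF line \<delta>(2)[OF near[OF t], unfolded gderiv_def]] .
      moreover have "((\<lambda>t. F (y + t *\<^sub>R e)) has_derivative (\<lambda>h. F' (y + t *\<^sub>R e) (h *\<^sub>R e))) (at t)"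
        using has_derivative_compose[OF line \<delta>(3)[OF near[OF t]]] .
      ultimately have "(k has_derivative (\<lambda>h. k' t * h)) (at t)"
        unfolding k_def k'_def
        by (auto intro!: derivative_eq_intros simp: lin[OF t] fun_eq_iff inner_add inner_diff
            inner_commute field_simps)
      then show ?thesis by (rule has_derivative_at_withinI)
    qed
    have bound: "onorm (\<lambda>h. k' t * h) \<le> c * (norm e)\<^sup>2" if t: "t \<in> {0..1}" for t
    proof -
      have "k' t = (F (y + t *\<^sub>R e) - F y - F' (y + t *\<^sub>R e) (y + t *\<^sub>R e - y)) \<bullet> e / 2"
        by (simp add: k'_def lin[OF t] inner_diff)
      also have "\<bar>\<dots>\<bar> \<le> norm (F (y + t *\<^sub>R e) - F y - F' (y + t *\<^sub>R e) (y + t *\<^sub>R e - y)) * norm e"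
        using Cauchy_Schwarz_ineq2[of "F (y + t *\<^sub>R e) - F y - F' (y + t *\<^sub>R e) (y + t *\<^sub>R e - y)" e]
        by simp
      also have "\<dots> \<le> c * norm (y + t *\<^sub>R e - y) * norm e"
        by (intro mult_right_mono \<delta>(4) near t) simp
      also have "\<dots> \<le> c * (1 * norm e) * norm e"
        using t \<open>c > 0\<close> mult_right_mono[of t 1 "norm e"] by (intro mult_right_mono mult_left_mono) auto
      finally have "\<bar>k' t\<bar> \<le> c * (norm e)\<^sup>2" by (simp add: power2_eq_square)
      then show ?thesis by (intro onorm_bound) (auto simp: abs_mult mult_right_mono \<open>c > 0\<close> less_imp_le)
    qed
    have "norm (k 1 - k 0) \<le> c * (norm e)\<^sup>2 * norm (1 - 0 :: real)"
      by (rule differentiable_bound[OF _ der bound]) auto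
    then show ?thesis by (simp add: k_def e_def)
  qed
  with \<delta>(1) show "\<forall>\<^sub>F x in nhds y. norm (f x - f y - (F x + F y) \<bullet> (x - y) / 2)
      \<le> c * norm ((norm (x - y))\<^sup>2)"
    unfolding eventually_nhds_metric by auto
qed

section \<open>A single partial polarization\<close>

locale pinning =
  fixes As Js \<kappa> :: real and Jp :: "real^3"
  assumes As_pos: "0 < As" and Js_pos: "0 < Js" and \<kappa>_nonneg: "0 \<le> \<kappa>"
begin

section \<open>The scalar force law and strong convexity of the energy\<close>

definition angle :: "real \<Rightarrow> real" where
  "angle r = pi / 2 * (r / Js)"

definition energy :: "real \<Rightarrow> real" where
  "energy r = - (2 * As * Js / pi) * ln (cos (angle r))"

definition force :: "real \<Rightarrow> real" where
  "force r = As * tan (angle r)"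

text \<open>The slope of \<open>force\<close> at the origin, where it is least; it is the convexity
  modulus of the energy.\<close>

definition stiffness :: real where
  "stiffness = As * pi / (2 * Js)"

definition force' :: "real \<Rightarrow> real" where
  "force' r = stiffness * (1 + (tan (angle r))\<^sup>2)"

lemma stiffness_pos: "0 < stiffness"
  using As_pos Js_pos by (simp add: stiffness_def)

lemma angle_bounds:
  assumes "\<bar>r\<bar> < Js" shows "- (pi / 2) < angle r" "angle r < pi / 2"
proof -
  have r: "- 1 < r / Js" "r / Js < 1" using assms Js_pos by (auto simp: field_simps)
  show "- (pi / 2) < angle r"
    using mult_strict_left_mono[OF r(1), of "pi / 2"] by (simp add: angle_def)
  show "angle r < pi / 2"
    using mult_strict_left_mono[OF r(2), of "pi / 2"] by (simp add: angle_def)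
qed

lemma cos_angle_pos: "\<bar>r\<bar> < Js \<Longrightarrow> 0 < cos (angle r)"
  using angle_bounds by (intro cos_gt_zero_pi)

lemma angle_deriv: "(angle has_real_derivative pi / (2 * Js)) (at r)"
  unfolding angle_def using Js_pos by (auto intro!: derivative_eq_intros)

lemma energy_deriv:
  assumes "\<bar>r\<bar> < Js" shows "(energy has_real_derivative force r) (at r)"
proof -
  have "((\<lambda>r. - (2 * As * Js / pi) * ln (cos (angle r))) has_real_derivative
      - (2 * As * Js / pi) * (inverse (cos (angle r)) * (- sin (angle r) * (pi / (2 * Js))))) (at r)"
    using cos_angle_pos[OF assms]
    by (auto intro!: derivative_eq_intros angle_deriv) (simp add: divide_inverse mult_ac)
  then show ?thesis
    using Js_pos by (simp add: energy_def[abs_def] force_def tan_def field_simps)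
qed

lemma force_deriv:
  assumes "\<bar>r\<bar> < Js" shows "(force has_real_derivative force' r) (at r)"
proof -
  have c: "cos (angle r) \<noteq> 0" using cos_angle_pos[OF assms] by simp
  have "((\<lambda>r. As * tan (angle r)) has_real_derivative
      As * (inverse ((cos (angle r))\<^sup>2) * (pi / (2 * Js)))) (at r)"
    by (intro DERIV_cmult DERIV_chain2[OF DERIV_tan[OF c] angle_deriv])
  also have "As * (inverse ((cos (angle r))\<^sup>2) * (pi / (2 * Js))) = force' r"
    unfolding force'_def tan_sec[OF c] by (simp add: stiffness_def power_inverse)
  finally show ?thesis by (simp add: force_def[abs_def])
qed

lemma isCont_force':
  assumes "\<bar>r\<bar> < Js" shows "isCont force' r"
proof -
  have "isCont angle r" using angle_deriv DERIV_isCont by blast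
  then show ?thesis
    unfolding force'_def using cos_angle_pos[OF assms] by (intro continuous_intros) auto
qed

lemma force_0 [simp]: "force 0 = 0"
  by (simp add: force_def angle_def)

lemma stiffness_le_force': "stiffness \<le> force' r"
  using stiffness_pos by (simp add: force'_def)

text \<open>The bound on \<open>force'\<close> integrated from the origin. As
  \<open>force r / r\<close> is the tangential curvature of the energy, both of its curvatures are
  at least the stiffness.\<close>

lemma stiffness_mult_le_force:
  assumes "0 \<le> r" "r < Js" shows "stiffness * r \<le> force r"
proof -
  have "force 0 - stiffness * 0 \<le> force r - stiffness * r"
  proof (rule DERIV_nonneg_imp_nondecreasing[OF assms(1)])
    fix x assume "0 \<le> x" "x \<le> r"
    then have "((\<lambda>x. force x - stiffness * x) has_real_derivative force' x - stiffness) (at x)"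
      using assms by (auto intro!: derivative_eq_intros force_deriv)
    then show "\<exists>y. ((\<lambda>x. force x - stiffness * x) has_real_derivative y) (at x) \<and> 0 \<le> y"
      using stiffness_le_force' by force
  qed
  then show ?thesis by simp
qed

definition field :: "real^3 \<Rightarrow> real^3" where
  "field J = force (norm J) *\<^sub>R sgn J"

definition field' :: "real^3 \<Rightarrow> real^3 \<Rightarrow> real^3" where
  "field' = radial_deriv force force'"

text \<open>With \<open>stiffness / 2 * r\<^sup>2\<close> removed, the profile \<open>k\<close> is
  still convex and nondecreasing in the radius, so its composition with the norm is convex. The
  removed square supplies the quadratic term.\<close>

lemma energy_lower:
  assumes "norm J < Js" "norm J' < Js"
  shows "energy (norm J) + field J \<bullet> (J' - J) + stiffness / 2 * (norm (J' - J))\<^sup>2 \<le> energy (norm J')"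
proof -
  define k where "k r = energy r - stiffness / 2 * r\<^sup>2" for r
  define k' where "k' r = force r - stiffness * r" for r
  have "k' (norm J) * (norm J' - norm J) \<le> k (norm J') - k (norm J)"
  proof (rule f''_imp_f'[where C = "{0..<Js}"])
    fix r assume "r \<in> {0..<Js}"
    then have r: "\<bar>r\<bar> < Js" by auto
    show "(k has_real_derivative k' r) (at r)"
      unfolding k_def k'_def by (auto intro!: derivative_eq_intros energy_deriv r)
    show "(k' has_real_derivative force' r - stiffness) (at r)"
      unfolding k'_def by (auto intro!: derivative_eq_intros force_deriv r)
    show "0 \<le> force' r - stiffness" using stiffness_le_force' by simp
  qed (use assms in auto)
  moreover have "k' (norm J) * (sgn J \<bullet> (J' - J)) \<le> k' (norm J) * (norm J' - norm J)"
  proof (rule mult_left_mono)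
    have "sgn J \<bullet> J' \<le> norm (sgn J) * norm J'" by (rule norm_cauchy_schwarz)
    also have "\<dots> \<le> 1 * norm J'" by (intro mult_right_mono) (auto simp: norm_sgn)
    finally show "sgn J \<bullet> (J' - J) \<le> norm J' - norm J" by (simp add: inner_diff inner_sgn_self)
    show "0 \<le> k' (norm J)" using stiffness_mult_le_force[of "norm J"] assms by (simp add: k'_def)
  qed
  ultimately have "k' (norm J) * (sgn J \<bullet> (J' - J)) \<le> k (norm J') - k (norm J)" by linarith
  moreover have "norm J *\<^sub>R sgn J = J" by (cases "J = 0") (simp_all add: sgn_div_norm)
  then have "norm J * (sgn J \<bullet> (J' - J)) = J \<bullet> (J' - J)" by (metis inner_scaleR_left)
  then have "k' (norm J) * (sgn J \<bullet> (J' - J)) = field J \<bullet> (J' - J) - stiffness * (J \<bullet> (J' - J))"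
    by (simp add: k'_def field_def left_diff_distrib mult.assoc)
  moreover have "stiffness / 2 * (norm (J' - J))\<^sup>2
      = stiffness / 2 * (norm J')\<^sup>2 - stiffness / 2 * (norm J)\<^sup>2 - stiffness * (J \<bullet> (J' - J))"
    by (simp add: power2_norm_eq_inner inner_diff inner_commute algebra_simps)
  ultimately show ?thesis by (simp add: k_def diff_divide_distrib)
qed

lemma energy_GDERIV:
  assumes "norm J < Js" shows "GDERIV (\<lambda>J::real^3. energy (norm J)) J :> field J"
proof (cases "J = 0")
  case False
  then show ?thesis
    using has_derivative_compose[OF has_derivative_norm[OF False]
        energy_deriv[of "norm J", unfolded has_field_derivative_def]] assms
    by (simp add: gderiv_def field_def)
next
  case True
  have "(energy has_real_derivative 0) (at 0)" using energy_deriv[of 0] Js_pos by simp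
  then have "((\<lambda>h. (energy h - energy 0) / h) \<longlongrightarrow> 0) (at 0)" by (simp add: DERIV_def)
  moreover have "filterlim (\<lambda>y::real^3. norm y) (at 0) (at 0)"
    by (auto simp: filterlim_at tendsto_norm_zero eventually_at_filter)
  ultimately have "((\<lambda>y::real^3. (energy (norm y) - energy 0) / norm y) \<longlongrightarrow> 0) (at 0)"
    by (rule filterlim_compose)
  then show ?thesis unfolding True gderiv_def
    by (intro has_derivativeI) (simp_all add: field_def divide_inverse mult.commute)
qed

lemma field_has_derivative:
  assumes "norm J < Js" shows "(field has_derivative field' J) (at J)"
  unfolding field_def[abs_def] field'_def
  by (intro radial_field_has_derivative force_deriv) (use assms in auto)

lemma eventually_less_Js:
  assumes "norm J < Js"
  shows "\<forall>\<^sub>F x in nhds J. norm x < Js"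
proof -
  have "(norm \<longlongrightarrow> norm J) (nhds J)" by (rule isCont_nhds) (intro continuous_intros)
  then show ?thesis using assms by (rule order_tendstoD(2))
qed

lemma field_strict_derivative:
  assumes "norm J < Js"
  shows "(\<lambda>x. norm (field x - field J - field' x (x - J))) \<in> o[nhds J](\<lambda>x. norm (x - J))"
  unfolding field_def[abs_def] field'_def
proof (rule radial_field_strict_derivative)
  have "\<forall>\<^sub>F r in nhds (norm J). \<bar>r\<bar> < Js"
    by (rule order_tendstoD(2)[OF isCont_nhds]) (use assms in \<open>auto intro!: continuous_intros\<close>)
  then show "\<forall>\<^sub>F r in nhds (norm J). (force has_real_derivative force' r) (at r)"
    by eventually_elim (rule force_deriv)
  show "isCont force' (norm J)" by (rule isCont_force') (use assms in simp)
qed simp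

lemma energy_trapezoid:
  assumes "norm J < Js"
  shows "(\<lambda>x. energy (norm x) - energy (norm J) - (field x + field J) \<bullet> (x - J) / 2)
    \<in> o[nhds J](\<lambda>x. (norm (x - J))\<^sup>2)"
proof (rule trapezoid_smallo)
  show "\<forall>\<^sub>F x in nhds J. GDERIV (\<lambda>J. energy (norm J)) x :> field x"
    using eventually_less_Js[OF assms] by eventually_elim (rule energy_GDERIV)
  show "\<forall>\<^sub>F x in nhds J. (field has_derivative field' x) (at x)"
    using eventually_less_Js[OF assms] by eventually_elim (rule field_has_derivative)
qed (rule field_strict_derivative[OF assms])

lemma field'_coercive:
  assumes "norm J < Js" shows "stiffness * (norm v)\<^sup>2 \<le> v \<bullet> field' J v"
proof -
  define q where "q = radial_slope force force' (norm J)"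
  have q: "stiffness \<le> q"
    using stiffness_le_force'[of 0] stiffness_mult_le_force[of "norm J"] assms
    by (auto simp: q_def radial_slope_def field_simps)
  have "stiffness * (norm v)\<^sup>2 = stiffness * ((norm v)\<^sup>2 - (sgn J \<bullet> v)\<^sup>2) + stiffness * (sgn J \<bullet> v)\<^sup>2"
    by (simp add: algebra_simps)
  also have "\<dots> \<le> q * ((norm v)\<^sup>2 - (sgn J \<bullet> v)\<^sup>2) + force' (norm J) * (sgn J \<bullet> v)\<^sup>2"
    using q stiffness_le_force' inner_sgn_squared_le[of J v] by (intro add_mono mult_right_mono) auto
  also have "\<dots> = v \<bullet> field' J v"
    by (simp add: field'_def inner_radial_deriv q_def[symmetric] power2_norm_eq_inner)
       (simp add: power2_eq_square algebra_simps)
  finally show ?thesis .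
qed

lemma field'_symmetric: "v \<bullet> field' J w = field' J v \<bullet> w"
  by (simp add: field'_def inner_radial_deriv inner_commute[of "radial_deriv _ _ _ _"])
     (simp add: inner_commute)

section \<open>Existence, uniqueness and equilibrium of the minimizer\<close>

definition objective :: "real^3 \<Rightarrow> real^3 \<Rightarrow> real" where
  "objective H J = energy (norm J) - J \<bullet> H + \<kappa> * norm (J - Jp)"

lemma pol_energy_eq:
  "pol_energy As Js \<kappa> Jp H J = (if norm J < Js then ereal (objective H J) else \<infinity>)"
  by (simp add: pol_energy_def internal_energy_def objective_def energy_def angle_def)

text \<open>The logarithm blows up at \<open>Js\<close>, so sublevel sets stay in a smaller closed
  ball. This is the compactness behind the existence of a minimizer.\<close>

lemma energy_sublevel:
  obtains r where "0 < r" "r < Js" "\<And>s. 0 \<le> s \<Longrightarrow> s < Js \<Longrightarrow> energy s \<le> C \<Longrightarrow> s \<le> r"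
proof -
  \<comment> \<open>The cosine at which the energy equals \<open>\<bar>C\<bar> + 1\<close>; the
    added one keeps \<open>c\<close> below 1 and thus \<open>r\<close> positive.\<close>
  define c where "c = exp (- (\<bar>C\<bar> + 1) * pi / (2 * As * Js))"
  have c: "0 < c" "c < 1" using As_pos Js_pos by (auto simp: c_def divide_neg_pos mult_neg_pos)
  define r where "r = Js * (arccos c / (pi / 2))"
  have "arccos c < arccos 0" "arccos 1 < arccos c"
    using c arccos_less_arccos[of 0 c] arccos_less_arccos[of c 1] by simp_all
  then have "0 < arccos c" "arccos c / (pi / 2) < 1" by (auto simp: field_simps)
  then have r: "0 < r" "r < Js"
    using Js_pos mult_strict_left_mono[of "arccos c / (pi / 2)" 1 Js] by (auto simp: r_def)
  have "s \<le> r" if s: "0 \<le> s" "s < Js" "energy s \<le> C" for s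
  proof -
    have pos: "0 < cos (angle s)" using s by (intro cos_angle_pos) auto
    have "- (2 * As * Js / pi) * ln (cos (angle s)) \<le> \<bar>C\<bar> + 1" using s(3) by (simp add: energy_def)
    then have "- (\<bar>C\<bar> + 1) * pi / (2 * As * Js) \<le> ln (cos (angle s))"
      using As_pos Js_pos by (simp add: field_simps)
    then have "c \<le> cos (angle s)" unfolding c_def using pos by (simp add: ln_ge_iff)
    then have "arccos (cos (angle s)) \<le> arccos c" using c by (intro arccos_le_arccos) auto
    moreover have "0 \<le> angle s" using s Js_pos by (simp add: angle_def)
    moreover have "angle s < pi / 2" using s by (intro angle_bounds) simp
    then have "angle s \<le> pi" using pi_gt_zero by linarith
    ultimately have "angle s \<le> arccos c" by (simp add: arccos_cos)
    then show ?thesis using Js_pos by (simp add: angle_def r_def field_simps)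
  qed
  with r that show ?thesis by blast
qed

lemma objective_min_exists:
  obtains J where "norm J < Js" "\<And>J'. norm J' < Js \<Longrightarrow> objective H J \<le> objective H J'"
proof -
  \<comment> \<open>Bounds the energy of every admissible competitor no worse than \<open>0\<close>,
    the linear term being at most \<open>Js * norm H\<close>.\<close>
  define C where "C = objective H 0 + Js * norm H"
  obtain r where r: "0 < r" "r < Js" "\<And>s. 0 \<le> s \<Longrightarrow> s < Js \<Longrightarrow> energy s \<le> C \<Longrightarrow> s \<le> r"
    using energy_sublevel[of C] by blast
  have "isCont (\<lambda>J::real^3. energy (norm J)) J" if "norm J < Js" for J
    using energy_GDERIV[OF that] unfolding gderiv_def by (rule has_derivative_continuous)
  then have "continuous_on (cball 0 r) (objective H)"
    unfolding objective_def[abs_def] using r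
    by (intro continuous_intros continuous_at_imp_continuous_on) auto
  moreover have "cball (0::real^3) r \<noteq> {}" using r by simp
  ultimately obtain J where J: "J \<in> cball 0 r" "\<And>J'. J' \<in> cball 0 r \<Longrightarrow> objective H J \<le> objective H J'"
    using continuous_attains_inf[OF compact_cball] by metis
  have "objective H J \<le> objective H J'" if J': "norm J' < Js" for J'
  proof (cases "objective H J' \<le> objective H 0")
    case True
    have "J' \<bullet> H \<le> norm J' * norm H" by (rule norm_cauchy_schwarz)
    also have "\<dots> \<le> Js * norm H" using J' by (intro mult_right_mono) auto
    moreover have "0 \<le> \<kappa> * norm (J' - Jp)" using \<kappa>_nonneg by simp
    ultimately have "energy (norm J') \<le> C"
      using True unfolding C_def objective_def[of H J'] by linarith
    then show ?thesis using r(3)[of "norm J'"] J' J(2)[of J'] by simp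
  next
    case False
    then show ?thesis using J(2)[of 0] r by simp
  qed
  moreover have "norm J < Js" using J(1) r by simp
  ultimately show ?thesis using that by simp
qed

definition equilibrium :: "real^3 \<Rightarrow> real^3 \<Rightarrow> bool" where
  "equilibrium H J \<longleftrightarrow> norm J < Js \<and> norm (H - field J) \<le> \<kappa>
    \<and> \<kappa> * norm (J - Jp) \<le> (H - field J) \<bullet> (J - Jp)"

text \<open>
  The two inequalities say that \<open>H - field J\<close> is a subgradient of \<open>\<lambda>J. \<kappa> * norm (J - Jp)\<close>.
\<close>

lemma min_imp_equilibrium:
  assumes J: "norm J < Js" and min: "\<And>J'. norm J' < Js \<Longrightarrow> objective H J \<le> objective H J'"
  shows "equilibrium H J"
proof -
  \<comment> \<open>The variational inequality. Later the direction \<open>H - field J\<close>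
    bounds the norm of that vector, and \<open>Jp - J\<close> gives its alignment with the
    displacement.\<close>
  have vi: "(H - field J) \<bullet> v \<le> \<kappa> * (norm (J + v - Jp) - norm (J - Jp))" for v
  proof (rule ccontr)
    define N where "N = norm (J + v - Jp) - norm (J - Jp)"
    \<comment> \<open>The pinning norm along the segment is replaced by its chord, so
      \<open>\<phi>\<close> is differentiable at \<open>0\<close>; by convexity and up to a constant
      it lies above the objective for \<open>0 < t \<le> 1\<close>.\<close>
    define \<phi> where "\<phi> t = energy (norm (J + t *\<^sub>R v)) - (J + t *\<^sub>R v) \<bullet> H + t * (\<kappa> * N)" for t
    assume "\<not> ?thesis"
    then have neg: "field J \<bullet> v - v \<bullet> H + \<kappa> * N < 0" by (simp add: N_def inner_diff inner_commute)
    have "((\<lambda>J. energy (norm J)) has_derivative (\<lambda>h. h \<bullet> field J)) (at (J + 0 *\<^sub>R v))"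
      using energy_GDERIV[OF J] by (simp add: gderiv_def)
    then have "((\<lambda>t. energy (norm (J + t *\<^sub>R v))) has_derivative (\<lambda>t. (t *\<^sub>R v) \<bullet> field J)) (at 0)"
      by (rule has_derivative_compose[rotated]) (auto intro!: derivative_eq_intros)
    then have d1: "((\<lambda>t. energy (norm (J + t *\<^sub>R v))) has_real_derivative field J \<bullet> v) (at 0)"
      by (simp add: has_field_derivative_def inner_commute mult.commute[of _ "v \<bullet> field J"])
    have d2: "((\<lambda>t. (J + t *\<^sub>R v) \<bullet> H) has_real_derivative v \<bullet> H) (at 0)"
      by (auto simp: inner_add intro!: derivative_eq_intros)
    have "(\<phi> has_real_derivative field J \<bullet> v - v \<bullet> H + \<kappa> * N) (at 0)"
      unfolding \<phi>_def by (auto intro!: derivative_eq_intros d1 d2)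
    from DERIV_neg_dec_right[OF this neg] obtain d where
      d: "d > 0" "\<And>t. 0 < t \<Longrightarrow> t < d \<Longrightarrow> \<phi> t < \<phi> 0" by auto
    have "isCont (\<lambda>t. norm (J + t *\<^sub>R v)) 0" by (intro continuous_intros)
    from order_tendstoD(2)[OF isCont_nhds[OF this], of Js]
    have "\<forall>\<^sub>F t in nhds 0. norm (J + t *\<^sub>R v) < Js" using J by simp
    then obtain d' where d': "d' > 0" "\<And>t. \<bar>t\<bar> < d' \<Longrightarrow> norm (J + t *\<^sub>R v) < Js"
      by (auto simp: eventually_nhds_metric)
    define t where "t = min (min d d' / 2) 1"
    have t: "0 < t" "t < d" "t < d'" "t \<le> 1" using d(1) d'(1) by (auto simp: t_def min_def)
    have "J + t *\<^sub>R v - Jp = (1 - t) *\<^sub>R (J - Jp) + t *\<^sub>R (J + v - Jp)" by (simp add: algebra_simps)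
    then have "norm (J + t *\<^sub>R v - Jp) \<le> norm ((1 - t) *\<^sub>R (J - Jp)) + norm (t *\<^sub>R (J + v - Jp))"
      by (metis norm_triangle_ineq)
    also have "\<dots> = norm (J - Jp) + t * N" 
      using t by (simp add: N_def left_diff_distrib right_diff_distrib)
    finally have "\<kappa> * norm (J + t *\<^sub>R v - Jp) \<le> \<kappa> * (norm (J - Jp) + t * N)"
      using \<kappa>_nonneg by (rule mult_left_mono)
    then have "objective H (J + t *\<^sub>R v) \<le> \<phi> t + \<kappa> * norm (J - Jp)"
      by (simp add: objective_def \<phi>_def algebra_simps)
    also have "\<dots> < \<phi> 0 + \<kappa> * norm (J - Jp)" using d(2) t by simp
    also have "\<dots> = objective H J" by (simp add: \<phi>_def objective_def)
    finally show False using min[of "J + t *\<^sub>R v"] d'(2)[of t] t by simp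
  qed
  define c where "c = H - field J"
  have "c \<bullet> c \<le> \<kappa> * (norm (J + c - Jp) - norm (J - Jp))" using vi[of c] by (simp add: c_def)
  also have "\<dots> \<le> \<kappa> * norm c"
    using norm_triangle_ineq[of "J - Jp" c] \<kappa>_nonneg
    by (intro mult_left_mono) (auto simp: algebra_simps)
  finally have "norm c * norm c \<le> \<kappa> * norm c" by (simp add: power2_eq_square flip: power2_norm_eq_inner)
  then have "norm c \<le> \<kappa>" using \<kappa>_nonneg by (cases "c = 0") auto
  moreover have "\<kappa> * norm (J - Jp) \<le> c \<bullet> (J - Jp)"
    using vi[of "Jp - J"] by (simp add: c_def inner_diff algebra_simps)
  ultimately show ?thesis using J by (simp add: equilibrium_def c_def)
qed

text \<open>Strong convexity of the energy plus the subgradient inequality of the pinning term.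
  Uniqueness of the minimizer and the dual estimates rest on this growth.\<close>

lemma objective_growth:
  assumes "equilibrium H J" and J': "norm J' < Js"
  shows "objective H J + stiffness / 2 * (norm (J' - J))\<^sup>2 \<le> objective H J'"
proof -
  have J: "norm J < Js" "norm (H - field J) \<le> \<kappa>" "\<kappa> * norm (J - Jp) \<le> (H - field J) \<bullet> (J - Jp)"
    using assms by (auto simp: equilibrium_def)
  have "(H - field J) \<bullet> (J' - Jp) \<le> norm (H - field J) * norm (J' - Jp)" by (rule norm_cauchy_schwarz)
  also have "\<dots> \<le> \<kappa> * norm (J' - Jp)" using J(2) by (intro mult_right_mono) auto
  finally have "(H - field J) \<bullet> (J' - J) \<le> \<kappa> * norm (J' - Jp) - \<kappa> * norm (J - Jp)"
    using J(3) by (simp add: inner_diff)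
  then show ?thesis
    using energy_lower[OF J(1) J'] by (simp add: objective_def inner_diff inner_commute)
qed

abbreviation pol :: "real^3 \<Rightarrow> real^3" where
  "pol \<equiv> polarization As Js \<kappa> Jp"

text \<open>Compactness gives a minimizer and quadratic growth its uniqueness, so the
  \<open>THE\<close> in \<open>polarization\<close> denotes it.\<close>

lemma equilibrium_pol: "equilibrium H (pol H)"
proof -
  obtain J where J: "norm J < Js" "\<And>J'. norm J' < Js \<Longrightarrow> objective H J \<le> objective H J'"
    using objective_min_exists by blast
  have eq: "equilibrium H J" by (rule min_imp_equilibrium[OF J])
  have "polarization As Js \<kappa> Jp H = J"
    unfolding polarization_def
  proof (rule the_equality)
    show "is_arg_min (pol_energy As Js \<kappa> Jp H) (\<lambda>_. True) J"
      using J by (auto simp: is_arg_min_def pol_energy_eq not_less)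
    fix J' assume "is_arg_min (pol_energy As Js \<kappa> Jp H) (\<lambda>_. True) J'"
    then have "\<not> pol_energy As Js \<kappa> Jp H J < pol_energy As Js \<kappa> Jp H J'"
      by (simp add: is_arg_min_def)
    then have "norm J' < Js" "objective H J' \<le> objective H J"
      using J(1) by (auto simp: pol_energy_eq not_less split: if_splits)
    then have "stiffness / 2 * (norm (J' - J))\<^sup>2 \<le> 0"
      using objective_growth[OF eq, of J'] by simp
    then show "J' = J" using stiffness_pos by (simp add: mult_le_0_iff)
  qed
  with eq show ?thesis by simp
qed

lemma norm_pol: "norm (pol H) < Js"
  using equilibrium_pol by (simp add: equilibrium_def)

lemma min_pol_energy: "real_of_ereal (INF J. pol_energy As Js \<kappa> Jp H J) = objective H (pol H)"
proof -
  have "(INF J. pol_energy As Js \<kappa> Jp H J) = ereal (objective H (pol H))"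
  proof (rule antisym)
    show "(INF J. pol_energy As Js \<kappa> Jp H J) \<le> ereal (objective H (pol H))"
      by (rule INF_lower2[of "pol H"]) (simp_all add: pol_energy_eq norm_pol)
    have "objective H (pol H) \<le> objective H J" if "norm J < Js" for J
      using objective_growth[OF equilibrium_pol that, of H] stiffness_pos
      by (smt (verit) divide_nonneg_pos mult_nonneg_nonneg zero_le_power2)
    then show "ereal (objective H (pol H)) \<le> (INF J. pol_energy As Js \<kappa> Jp H J)"
      by (intro INF_greatest) (simp add: pol_energy_eq)
  qed
  then show ?thesis by simp
qed

section \<open>Dual estimates for one summand of the co-energy\<close>

definition coenergy_pol :: "real^3 \<Rightarrow> real" where
  "coenergy_pol H = - objective H (pol H)"

text \<open>\<open>pol H\<close> is a competitor at the field \<open>H'\<close>, where growth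
  charges its distance to \<open>pol H'\<close>, and the objective is affine in the field.
  Convexity, smoothness and the Lipschitz bound on \<open>pol\<close> all follow.\<close>

lemma coenergy_pol_growth:
  "coenergy_pol H + pol H \<bullet> (H' - H) + stiffness / 2 * (norm (pol H' - pol H))\<^sup>2 \<le> coenergy_pol H'"
proof -
  have "objective H' (pol H') + stiffness / 2 * (norm (pol H - pol H'))\<^sup>2 \<le> objective H' (pol H)"
    by (rule objective_growth[OF equilibrium_pol norm_pol])
  moreover have "objective H' (pol H) = objective H (pol H) - pol H \<bullet> (H' - H)"
    by (simp add: objective_def inner_diff)
  ultimately show ?thesis by (simp add: coenergy_pol_def norm_minus_commute)
qed

lemma coenergy_pol_lower: "coenergy_pol H + pol H \<bullet> (H' - H) \<le> coenergy_pol H'"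
  using coenergy_pol_growth[of H H'] stiffness_pos
  by (smt (verit) divide_nonneg_pos mult_nonneg_nonneg zero_le_power2)

text \<open>Growth with \<open>H\<close> and \<open>H'\<close> exchanged leaves
  \<open>a \<bullet> e - stiffness / 2 * (norm a)\<^sup>2\<close>, whose maximum over
  \<open>a\<close> is the quadratic term.\<close>

lemma coenergy_pol_upper:
  "coenergy_pol H' \<le> coenergy_pol H + pol H \<bullet> (H' - H) + 1 / stiffness / 2 * (norm (H' - H))\<^sup>2"
proof -
  define a where "a = pol H' - pol H"
  define e where "e = H' - H"
  have "coenergy_pol H' \<le> coenergy_pol H + pol H' \<bullet> e - stiffness / 2 * (norm a)\<^sup>2"
    using coenergy_pol_growth[of H' H] by (simp add: a_def e_def norm_minus_commute inner_diff)
  also have "pol H' \<bullet> e = pol H \<bullet> e + a \<bullet> e" by (simp add: a_def inner_diff)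
  finally have 1: "coenergy_pol H' \<le> coenergy_pol H + pol H \<bullet> e + a \<bullet> e - stiffness / 2 * (norm a)\<^sup>2"
    by simp
  have "0 \<le> (norm (stiffness *\<^sub>R a - e))\<^sup>2" by simp
  also have "\<dots> = stiffness * stiffness * (norm a)\<^sup>2 - 2 * stiffness * (a \<bullet> e) + (norm e)\<^sup>2"
    by (simp add: power2_norm_eq_inner inner_diff inner_commute algebra_simps)
  finally have "a \<bullet> e - stiffness / 2 * (norm a)\<^sup>2 \<le> 1 / stiffness / 2 * (norm e)\<^sup>2"
    using stiffness_pos by (simp add: field_simps)
  with 1 show ?thesis by (simp add: e_def)
qed

lemma norm_pol_diff_le: "norm (pol H' - pol H) \<le> 1 / stiffness * norm (H' - H)"
proof -
  have "stiffness * (norm (pol H' - pol H))\<^sup>2 \<le> (pol H' - pol H) \<bullet> (H' - H)"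
    using coenergy_pol_growth[of H H'] coenergy_pol_growth[of H' H]
    by (simp add: norm_minus_commute inner_diff algebra_simps)
  also have "\<dots> \<le> norm (pol H' - pol H) * norm (H' - H)" by (rule norm_cauchy_schwarz)
  finally have "stiffness * norm (pol H' - pol H) \<le> norm (H' - H)"
    by (cases "pol H' = pol H") (simp_all add: power2_eq_square)
  then show ?thesis using stiffness_pos by (simp add: field_simps)
qed

section \<open>The slope matrix and its inverse, the generalized Jacobian\<close>

lemma hessian_energy:
  assumes "norm J < Js"
  shows "hessian (\<lambda>X. real_of_ereal (internal_energy As Js X)) J *v v = field' J v"
proof -
  let ?U = "\<lambda>X::real^3. real_of_ereal (internal_energy As Js X)"
  have U: "energy (norm X) = ?U X" if "X \<in> ball 0 Js" for X
    using that by (simp add: internal_energy_def energy_def angle_def)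
  have grad: "field X = gradient ?U X" if X: "X \<in> ball 0 Js" for X
  proof (rule gradient_eq[symmetric])
    show "GDERIV ?U X :> field X" unfolding gderiv_def
      by (rule has_derivative_transform_within_open[OF _ open_ball X U])
         (use energy_GDERIV X in \<open>auto simp: gderiv_def\<close>)
  qed
  have J: "J \<in> ball 0 Js" using assms by simp
  have "(gradient ?U has_derivative field' J) (at J)"
    by (rule has_derivative_transform_within_open[OF field_has_derivative[OF assms] open_ball J grad])
  moreover from this have "(gradient ?U has_derivative (\<lambda>h. jacobian (gradient ?U) (at J) *v h)) (at J)"
    using jacobian_works differentiableI by blast
  ultimately show ?thesis unfolding hessian_def by (metis has_derivative_unique)
qed

text \<open>For \<open>J \<noteq> Jp\<close> this is the derivative of
  \<open>\<lambda>J. field J + \<kappa> *\<^sub>R sgn (J - Jp)\<close>, the map that recovers the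
  field from an unpinned polarization.\<close>

definition slope_matrix :: "real^3 \<Rightarrow> real^3^3" where
  "slope_matrix J = hessian (\<lambda>X. real_of_ereal (internal_energy As Js X)) J
    + (\<kappa> / norm (J - Jp)) *\<^sub>R (mat 1 - (1 / (norm (J - Jp))\<^sup>2) *\<^sub>R outer (J - Jp) (J - Jp))"

lemma slope_matrix_mult:
  assumes "norm J < Js"
  shows "slope_matrix J *v v = field' J v
    + (\<kappa> / norm (J - Jp)) *\<^sub>R (v - (sgn (J - Jp) \<bullet> v) *\<^sub>R sgn (J - Jp))"
proof -
  have outer: "outer d d *v v = (d \<bullet> v) *\<^sub>R d" for d :: "real^3"
    by (simp add: outer_def matrix_vector_mult_def inner_vec_def vec_eq_iff sum_distrib_left mult_ac)
  have "(1 / (norm d)\<^sup>2) *\<^sub>R ((d \<bullet> v) *\<^sub>R d) = (sgn d \<bullet> v) *\<^sub>R sgn d" for d :: "real^3"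
    by (simp add: sgn_div_norm power2_eq_square divide_inverse)
  then show ?thesis
    by (simp add: slope_matrix_def matrix_vector_mult_add_rdistrib matrix_vector_mult_diff_rdistrib
        hessian_energy[OF assms] outer scaleR_matrix_vector_assoc[symmetric])
qed

lemma slope_matrix_quadratic:
  assumes "norm J < Js"
  shows "stiffness * (norm v)\<^sup>2 + \<kappa> / norm (J - Jp) * ((norm v)\<^sup>2 - (sgn (J - Jp) \<bullet> v)\<^sup>2)
    \<le> v \<bullet> (slope_matrix J *v v)"
proof -
  have "v \<bullet> (v - (s \<bullet> v) *\<^sub>R s) = (norm v)\<^sup>2 - (s \<bullet> v)\<^sup>2" for s
    unfolding power2_norm_eq_inner by (simp add: inner_diff inner_commute power2_eq_square)
  then show ?thesis
    using field'_coercive[OF assms, of v] by (simp add: slope_matrix_mult[OF assms] inner_add)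
qed

text \<open>At \<open>J = Jp\<close> division by zero removes the pinning term and the bound
  persists, so \<open>slope_facts\<close> hold at every \<open>pol H\<close> without a case
  distinction.\<close>

lemma slope_matrix_coercive:
  assumes "norm J < Js"
  shows "stiffness * (norm v)\<^sup>2 \<le> v \<bullet> (slope_matrix J *v v)"
proof -
  have "0 \<le> \<kappa> / norm (J - Jp) * ((norm v)\<^sup>2 - (sgn (J - Jp) \<bullet> v)\<^sup>2)"
    using \<kappa>_nonneg inner_sgn_squared_le[of "J - Jp" v] by simp
  then show ?thesis using slope_matrix_quadratic[OF assms, of v] by linarith
qed

lemma slope_matrix_sym:
  assumes "norm J < Js"
  shows "transpose (slope_matrix J) = slope_matrix J"
  unfolding transpose_eq_iff
  using field'_symmetric
  by (simp add: slope_matrix_mult[OF assms] inner_add inner_diff inner_commute)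

abbreviation jac :: "real^3 \<Rightarrow> real^3^3" where
  "jac \<equiv> gen_jacobian_pol As Js \<kappa> Jp"

lemma jac_eq: "jac H = (if pol H = Jp then 0 else matrix_inv (slope_matrix (pol H)))"
  by (simp add: gen_jacobian_pol_def Let_def slope_matrix_def)

lemmas slope_facts = slope_matrix_sym[OF norm_pol] stiffness_pos slope_matrix_coercive[OF norm_pol]

lemma jac_sym: "transpose (jac H) = jac H"
  using coercive_inv_sym[OF slope_facts] by (simp add: jac_eq transpose_def vec_eq_iff)

lemma jac_nonneg: "0 \<le> v \<bullet> (jac H *v v)"
  using coercive_inv_nonneg[OF slope_facts] by (simp add: jac_eq)

lemma jac_upper: "v \<bullet> (jac H *v v) \<le> 1 / stiffness * (norm v)\<^sup>2"
  using coercive_inv_upper[OF slope_facts] stiffness_pos by (simp add: jac_eq)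

lemma jac_norm: "norm (jac H *v v) \<le> 1 / stiffness * norm v"
  using coercive_inv_norm[OF slope_facts] stiffness_pos by (simp add: jac_eq)

lemma jac_slope: "pol H \<noteq> Jp \<Longrightarrow> jac H *v (slope_matrix (pol H) *v v) = v"
  using coercive_inv(2)[OF slope_facts] by (simp add: jac_eq)

lemma slope_jac: "pol H \<noteq> Jp \<Longrightarrow> slope_matrix (pol H) *v (jac H *v v) = v"
  using coercive_inv(1)[OF slope_facts] by (simp add: jac_eq)

text \<open>
  Near the pinning point the radial part of the matrix stays bounded while the tangential part
  blows up, so the inverse maps nearly tangential vectors to small ones.
\<close>

lemma jac_tangential:
  assumes unpinned: "pol H \<noteq> Jp" and \<kappa>_pos: "0 < \<kappa>"
  shows "(norm (jac H *v y))\<^sup>2 \<le> (sgn (pol H - Jp) \<bullet> y)\<^sup>2 / stiffness\<^sup>2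
    + norm (pol H - Jp) * (norm y)\<^sup>2 / (2 * \<kappa> * stiffness)"
proof -
  define x where "x = jac H *v y"
  define r where "r = norm (pol H - Jp)"
  define s where "s = sgn (pol H - Jp)"
  define P where "P = x - (s \<bullet> x) *\<^sub>R s"
  have r: "0 < r" using unpinned by (simp add: r_def)
  have s: "norm s = 1" "s \<bullet> s = 1" using unpinned by (simp_all add: s_def norm_sgn flip: power2_norm_eq_inner)
  have P: "(norm P)\<^sup>2 = (norm x)\<^sup>2 - (s \<bullet> x)\<^sup>2"
    unfolding P_def power2_norm_eq_inner
    by (simp add: inner_diff inner_commute s power2_eq_square)
  have "stiffness * (norm x)\<^sup>2 + \<kappa> / r * (norm P)\<^sup>2 \<le> x \<bullet> y"
    using slope_matrix_quadratic[OF norm_pol[of H], of x] slope_jac[OF unpinned, of y]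
    unfolding P by (simp add: x_def r_def s_def)
  also have "x \<bullet> y = (s \<bullet> x) * (s \<bullet> y) + P \<bullet> y"
    by (simp add: P_def inner_diff inner_commute)
  \<comment> \<open>Young's inequality, with half of the stiffness term absorbed on the left. The
    tangential product is then absorbed by the whole \<open>\<kappa> / r\<close> term, which leaves
    the factor \<open>r\<close> that vanishes at the pinning point.\<close>
  also have "(s \<bullet> x) * (s \<bullet> y) \<le> stiffness / 2 * (norm x)\<^sup>2 + (s \<bullet> y)\<^sup>2 / (2 * stiffness)"
  proof -
    have "0 \<le> (stiffness * (s \<bullet> x) - s \<bullet> y)\<^sup>2 / (2 * stiffness)" using stiffness_pos by simp
    also have "\<dots> = stiffness / 2 * (s \<bullet> x)\<^sup>2 + (s \<bullet> y)\<^sup>2 / (2 * stiffness) - (s \<bullet> x) * (s \<bullet> y)"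
      using stiffness_pos by (simp add: power2_diff power_mult_distrib field_simps power2_eq_square)
    also have "stiffness / 2 * (s \<bullet> x)\<^sup>2 \<le> stiffness / 2 * (norm x)\<^sup>2"
      using inner_sgn_squared_le[of "pol H - Jp" x] stiffness_pos by (simp add: s_def)
    finally show ?thesis by simp
  qed
  also have "P \<bullet> y \<le> \<kappa> / r * (norm P)\<^sup>2 + r / (4 * \<kappa>) * (norm y)\<^sup>2"
  proof -
    have "P \<bullet> y \<le> norm P * norm y" by (rule norm_cauchy_schwarz)
    moreover have "0 \<le> (2 * \<kappa> * norm P - r * norm y)\<^sup>2 / (4 * \<kappa> * r)" using \<kappa>_pos r by simp
    moreover have "(2 * \<kappa> * norm P - r * norm y)\<^sup>2 / (4 * \<kappa> * r)
        = \<kappa> / r * (norm P)\<^sup>2 + r / (4 * \<kappa>) * (norm y)\<^sup>2 - norm P * norm y"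
      using \<kappa>_pos r by (simp add: power2_diff power_mult_distrib field_simps power2_eq_square)
    ultimately show ?thesis by linarith
  qed
  finally have "stiffness / 2 * (norm x)\<^sup>2 \<le> (s \<bullet> y)\<^sup>2 / (2 * stiffness) + r / (4 * \<kappa>) * (norm y)\<^sup>2"
    by simp
  then have "2 / stiffness * (stiffness / 2 * (norm x)\<^sup>2)
      \<le> 2 / stiffness * ((s \<bullet> y)\<^sup>2 / (2 * stiffness) + r / (4 * \<kappa>) * (norm y)\<^sup>2)"
    using stiffness_pos by (intro mult_left_mono) auto
  then show ?thesis
    using stiffness_pos \<kappa>_pos by (simp add: x_def r_def s_def distrib_left power2_eq_square mult_ac)
qed

section \<open>Expansions along the polarization in terms of the field\<close>

lemma pol_tendsto: "filterlim pol (nhds (pol H\<^sub>0)) (nhds H\<^sub>0)"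
proof -
  have "((\<lambda>H. 1 / stiffness * norm (H - H\<^sub>0)) \<longlongrightarrow> 1 / stiffness * norm (H\<^sub>0 - H\<^sub>0)) (nhds H\<^sub>0)"
    by (intro isCont_nhds continuous_intros)
  then have "((\<lambda>H. 1 / stiffness * norm (H - H\<^sub>0)) \<longlongrightarrow> 0) (nhds H\<^sub>0)" by simp
  then have "((\<lambda>H. pol H - pol H\<^sub>0) \<longlongrightarrow> 0) (nhds H\<^sub>0)"
    by (rule Lim_null_comparison[OF eventuallyI[OF norm_pol_diff_le]])
  then show ?thesis by (simp add: Lim_null[symmetric])
qed

lemma pol_diff_bigo: "(\<lambda>H. norm (pol H - pol H\<^sub>0)) \<in> O[nhds H\<^sub>0](\<lambda>H. norm (H - H\<^sub>0))"
  using norm_pol_diff_le by (intro bigoI[of _ "1 / stiffness"] eventuallyI) simp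

lemma field_pol_strict:
  "(\<lambda>H. norm (field (pol H) - field (pol H\<^sub>0) - field' (pol H) (pol H - pol H\<^sub>0)))
    \<in> o[nhds H\<^sub>0](\<lambda>H. norm (H - H\<^sub>0))"
  using landau_o.small.compose[OF field_strict_derivative[OF norm_pol] pol_tendsto] pol_diff_bigo
  by (rule landau_o.small_big_trans)

lemma energy_pol_trapezoid:
  "(\<lambda>H. energy (norm (pol H)) - energy (norm (pol H\<^sub>0))
      - (field (pol H) + field (pol H\<^sub>0)) \<bullet> (pol H - pol H\<^sub>0) / 2)
    \<in> o[nhds H\<^sub>0](\<lambda>H. (norm (H - H\<^sub>0))\<^sup>2)"
  using landau_o.small.compose[OF energy_trapezoid[OF norm_pol] pol_tendsto]
    landau_o.big_power[OF pol_diff_bigo]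
  by (rule landau_o.small_big_trans)

lemma field_pol_bigo: "(\<lambda>H. norm (field (pol H) - field (pol H\<^sub>0))) \<in> O[nhds H\<^sub>0](\<lambda>H. norm (H - H\<^sub>0))"
proof -
  define J where "J = pol H\<^sub>0"
  obtain K where K: "\<And>v. norm (field' J v) \<le> norm v * K"
    using field_has_derivative[OF norm_pol[of H\<^sub>0]] has_derivative_bounded_linear bounded_linear.bounded
    unfolding J_def by blast
  have lim: "((\<lambda>x. (field x - field J - field' J (x - J)) /\<^sub>R norm (x - J)) \<longlongrightarrow> 0) (at J)"
    using field_has_derivative[OF norm_pol[of H\<^sub>0]] unfolding J_def by (simp add: has_derivative_def netlimit_at_vector)
  have "\<forall>\<^sub>F x in at J. norm ((field x - field J - field' J (x - J)) /\<^sub>R norm (x - J)) < 1"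
    using tendstoD[OF lim, of 1] by simp
  then have "\<forall>\<^sub>F x in nhds J. x \<noteq> J \<longrightarrow> norm ((field x - field J - field' J (x - J)) /\<^sub>R norm (x - J)) < 1"
    by (simp add: eventually_at_filter)
  then have "\<forall>\<^sub>F x in nhds J. norm (field x - field J) \<le> (1 + K) * norm (x - J)"
  proof eventually_elim
    case (elim x)
    show ?case
    proof (cases "x = J")
      case False
      then have "inverse (norm (x - J)) * norm (field x - field J - field' J (x - J)) < 1"
        using elim by (simp only: norm_scaleR abs_inverse abs_norm_cancel) blast
      then have "norm (field x - field J - field' J (x - J)) \<le> norm (x - J)"
        using False by (simp add: field_simps)
      then have "norm (field x - field J) \<le> norm (x - J) + norm (field' J (x - J))"
        using norm_triangle_sub[of "field x - field J" "field' J (x - J)"] by linarith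
      then show ?thesis using K[of "x - J"] by (simp add: algebra_simps)
    qed simp
  qed
  then have "(\<lambda>x. norm (field x - field J)) \<in> O[nhds J](\<lambda>x. norm (x - J))"
    by (intro bigoI[of _ "1 + K"]) simp
  from landau_o.big_trans[OF landau_o.big.compose[OF this pol_tendsto[of H\<^sub>0, folded J_def]]]
  show ?thesis using pol_diff_bigo[of H\<^sub>0] by (simp add: J_def)
qed

section \<open>The pinning force and semismoothness of the polarization\<close>

abbreviation pull :: "real^3 \<Rightarrow> real^3" where
  "pull H \<equiv> H - field (pol H)"

text \<open>The equilibrium inequalities force equality in Cauchy-Schwarz; the squared distance to
  \<open>\<kappa> *\<^sub>R s\<close> expands to at most zero.\<close>

lemma pull_unpinned:
  assumes "pol H \<noteq> Jp" shows "pull H = \<kappa> *\<^sub>R sgn (pol H - Jp)"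
proof -
  define s where "s = sgn (pol H - Jp)"
  have s: "norm s = 1" using assms by (simp add: s_def norm_sgn)
  have eq: "norm (pull H) \<le> \<kappa>" "\<kappa> * norm (pol H - Jp) \<le> pull H \<bullet> (pol H - Jp)"
    using equilibrium_pol[of H] by (auto simp: equilibrium_def)
  have "pol H - Jp = norm (pol H - Jp) *\<^sub>R s" using assms by (simp add: s_def sgn_div_norm)
  then have "\<kappa> * norm (pol H - Jp) \<le> (pull H \<bullet> s) * norm (pol H - Jp)"
    using eq(2) by (metis inner_scaleR_right mult.commute)
  then have ge: "\<kappa> \<le> pull H \<bullet> s" using assms by simp
  have "(norm (pull H - \<kappa> *\<^sub>R s))\<^sup>2 = (norm (pull H))\<^sup>2 - 2 * \<kappa> * (pull H \<bullet> s) + \<kappa>\<^sup>2 * (norm s)\<^sup>2"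
    unfolding power2_norm_eq_inner
    by (simp add: inner_diff inner_commute power2_eq_square algebra_simps)
  also have "\<dots> \<le> \<kappa>\<^sup>2 - 2 * \<kappa> * \<kappa> + \<kappa>\<^sup>2 * 1\<^sup>2"
    using eq(1) ge \<kappa>_nonneg s by (intro add_mono diff_mono power_mono mult_left_mono) auto
  also have "\<dots> = 0" by (simp add: power2_eq_square)
  finally show ?thesis by (simp add: s_def)
qed

text \<open>Since \<open>J \<bullet> H - J0 \<bullet> H0 - (J + J0) \<bullet> (H - H0) / 2 = (H +
  H0) \<bullet> (J - J0) / 2\<close>, the trapezoidal defect passes through the Legendre transform
  with reversed sign. Writing the field as \<open>field\<close> plus \<open>pull\<close> separates
  the defects of the energy and of the pinning term.\<close>

lemma coenergy_pol_trapezoid_identity: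
  "coenergy_pol H - coenergy_pol H\<^sub>0 - (pol H + pol H\<^sub>0) \<bullet> (H - H\<^sub>0) / 2
    = (pull H + pull H\<^sub>0) \<bullet> (pol H - pol H\<^sub>0) / 2 - \<kappa> * (norm (pol H - Jp) - norm (pol H\<^sub>0 - Jp))
      - (energy (norm (pol H)) - energy (norm (pol H\<^sub>0))
        - (field (pol H) + field (pol H\<^sub>0)) \<bullet> (pol H - pol H\<^sub>0) / 2)"
  by (simp add: coenergy_pol_def objective_def inner_add inner_diff inner_commute field_simps)

text \<open>The two summands of
  \<open>H = field (pol H) + \<kappa> *\<^sub>R sgn (pol H - Jp)\<close> are expanded with
  derivatives at \<open>pol H\<close>, so the slope matrix there maps the change of polarization to
  the change of field up to small errors, and its inverse is bounded. The pinning defect in the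
  second claim is of third order.\<close>

lemma semismooth_unpinned:
  assumes "pol H\<^sub>0 \<noteq> Jp"
  shows "(\<lambda>H. norm (pol H - pol H\<^sub>0 - jac H *v (H - H\<^sub>0))) \<in> o[nhds H\<^sub>0](\<lambda>H. norm (H - H\<^sub>0))"
    and "(\<lambda>H. coenergy_pol H - coenergy_pol H\<^sub>0 - (pol H + pol H\<^sub>0) \<bullet> (H - H\<^sub>0) / 2)
      \<in> o[nhds H\<^sub>0](\<lambda>H. (norm (H - H\<^sub>0))\<^sup>2)"
proof -
  let ?d = "\<lambda>H. pol H - Jp"
  let ?err = "\<lambda>d. norm (\<kappa> *\<^sub>R sgn d - \<kappa> *\<^sub>R sgn (?d H\<^sub>0) - radial_deriv (\<lambda>_. \<kappa>) (\<lambda>_. 0) d (d - ?d H\<^sub>0))"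
  have unpinned: "\<forall>\<^sub>F H in nhds H\<^sub>0. pol H \<noteq> Jp"
    using eventually_compose_filterlim[OF t1_space_nhds[OF assms] pol_tendsto] .
  have lim: "filterlim ?d (nhds (?d H\<^sub>0)) (nhds H\<^sub>0)"
    by (intro tendsto_intros pol_tendsto)
  have "?err \<in> o[nhds (?d H\<^sub>0)](\<lambda>d. norm (d - ?d H\<^sub>0))"
    by (rule radial_field_strict_derivative) (use assms in auto)
  from landau_o.small.compose[OF this lim]
  have "(\<lambda>H. ?err (?d H)) \<in> o[nhds H\<^sub>0](\<lambda>H. norm (pol H - pol H\<^sub>0))" by simp
  then have err: "(\<lambda>H. ?err (?d H)) \<in> o[nhds H\<^sub>0](\<lambda>H. norm (H - H\<^sub>0))"
    using pol_diff_bigo by (rule landau_o.small_big_trans)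
  let ?q = "\<lambda>H. norm (field (pol H) - field (pol H\<^sub>0) - field' (pol H) (pol H - pol H\<^sub>0))"
  have "(\<lambda>H. ?q H + ?err (?d H)) \<in> o[nhds H\<^sub>0](\<lambda>H. norm (H - H\<^sub>0))"
    by (intro sum_in_smallo err field_pol_strict)
  moreover have "(\<lambda>H. norm (pol H - pol H\<^sub>0 - jac H *v (H - H\<^sub>0))) \<in> O[nhds H\<^sub>0](\<lambda>H. ?q H + ?err (?d H))"
  proof (rule bigoI[of _ "1 / stiffness"], use unpinned in eventually_elim)
    fix H assume H: "pol H \<noteq> Jp"
    let ?E1 = "field (pol H) - field (pol H\<^sub>0) - field' (pol H) (pol H - pol H\<^sub>0)"
    let ?E2 = "\<kappa> *\<^sub>R sgn (?d H) - \<kappa> *\<^sub>R sgn (?d H\<^sub>0) - radial_deriv (\<lambda>_. \<kappa>) (\<lambda>_. 0) (?d H) (pol H - pol H\<^sub>0)"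
    have "slope_matrix (pol H) *v (pol H - pol H\<^sub>0)
      = field' (pol H) (pol H - pol H\<^sub>0) + radial_deriv (\<lambda>_. \<kappa>) (\<lambda>_. 0) (?d H) (pol H - pol H\<^sub>0)"
      using H by (simp add: slope_matrix_mult[OF norm_pol] radial_deriv_def radial_slope_def
          scaleR_diff_right)
    moreover have "H - H\<^sub>0 = field (pol H) - field (pol H\<^sub>0) + (\<kappa> *\<^sub>R sgn (?d H) - \<kappa> *\<^sub>R sgn (?d H\<^sub>0))"
      unfolding pull_unpinned[OF H, symmetric] pull_unpinned[OF assms, symmetric] by simp
    ultimately have "slope_matrix (pol H) *v (pol H - pol H\<^sub>0) - (H - H\<^sub>0) = - (?E1 + ?E2)"
      by simp
    then have "pol H - pol H\<^sub>0 - jac H *v (H - H\<^sub>0) = jac H *v (- (?E1 + ?E2))"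
      using jac_slope[OF H, of "pol H - pol H\<^sub>0"]
      by (metis matrix_vector_mult_diff_distrib)
    then have "norm (pol H - pol H\<^sub>0 - jac H *v (H - H\<^sub>0)) \<le> 1 / stiffness * norm (?E1 + ?E2)"
      using jac_norm[of H "- (?E1 + ?E2)"] by (simp only: norm_minus_cancel)
    also have "\<dots> \<le> 1 / stiffness * (norm ?E1 + norm ?E2)"
      using stiffness_pos by (intro mult_left_mono norm_triangle_ineq) simp
    finally show "norm (norm (pol H - pol H\<^sub>0 - jac H *v (H - H\<^sub>0)))
      \<le> 1 / stiffness * norm (?q H + ?err (?d H))" by simp
  qed
  ultimately show "(\<lambda>H. norm (pol H - pol H\<^sub>0 - jac H *v (H - H\<^sub>0))) \<in> o[nhds H\<^sub>0](\<lambda>H. norm (H - H\<^sub>0))"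
    by (rule landau_o.big_small_trans[rotated])
  let ?u = "\<lambda>H. norm (sgn (?d H) - sgn (?d H\<^sub>0))"
  have "?u \<in> O[nhds H\<^sub>0](\<lambda>H. norm (pol H - pol H\<^sub>0))"
    using norm_sgn_diff_le[of "?d H\<^sub>0" "?d H" for H] assms
    by (intro bigoI[of _ "2 / norm (?d H\<^sub>0)"] eventuallyI) simp
  then have u: "?u \<in> O[nhds H\<^sub>0](\<lambda>H. norm (H - H\<^sub>0))"
    using pol_diff_bigo by (rule landau_o.big_trans)
  have "?u \<in> o[nhds H\<^sub>0](\<lambda>_. 1)"
  proof (rule smalloI_tendsto)
    have "(?u \<longlongrightarrow> norm (sgn (?d H\<^sub>0) - sgn (?d H\<^sub>0))) (nhds H\<^sub>0)"
      using assms by (intro tendsto_intros lim) auto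
    then show "((\<lambda>H. ?u H / 1) \<longlongrightarrow> 0) (nhds H\<^sub>0)" by simp
  qed simp
  then have "(\<lambda>H. norm (pol H - pol H\<^sub>0) * (?u H * ?u H)) \<in> o[nhds H\<^sub>0](\<lambda>H. norm (H - H\<^sub>0) * (norm (H - H\<^sub>0) * 1))"
    by (intro landau_o.mult pol_diff_bigo u)
  then have cubic: "(\<lambda>H. norm (pol H - pol H\<^sub>0) * (?u H * ?u H)) \<in> o[nhds H\<^sub>0](\<lambda>H. (norm (H - H\<^sub>0))\<^sup>2)"
    by (simp add: power2_eq_square)
  have "(\<lambda>H. (pull H + pull H\<^sub>0) \<bullet> (pol H - pol H\<^sub>0) / 2 - \<kappa> * (norm (?d H) - norm (?d H\<^sub>0)))
    \<in> O[nhds H\<^sub>0](\<lambda>H. norm (pol H - pol H\<^sub>0) * (?u H * ?u H))"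
  proof (rule bigoI[of _ \<kappa>], use unpinned in eventually_elim)
    fix H assume H: "pol H \<noteq> Jp"
    define s s0 r r0 where "s = sgn (?d H)" "s0 = sgn (?d H\<^sub>0)" "r = norm (?d H)" "r0 = norm (?d H\<^sub>0)"
    note defs = this
    have d: "?d H = r *\<^sub>R s" "?d H\<^sub>0 = r0 *\<^sub>R s0" using H assms by (simp_all add: defs sgn_div_norm)
    have s: "norm s = 1" "norm s0 = 1" using H assms by (simp_all add: defs norm_sgn)
    then have ss: "s \<bullet> s = 1" "s0 \<bullet> s0 = 1" by (simp_all flip: power2_norm_eq_inner)
    have diff: "pol H - pol H\<^sub>0 = r *\<^sub>R s - r0 *\<^sub>R s0" by (simp flip: d)
    \<comment> \<open>The defect collapses to the change of length times
      \<open>s \<bullet> s0 - 1\<close>, which is minus half the squared chord.\<close>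
    have "(pull H + pull H\<^sub>0) \<bullet> (pol H - pol H\<^sub>0) / 2 - \<kappa> * (r - r0)
      = \<kappa> * ((r - r0) * (s \<bullet> s0 - 1) / 2)"
      unfolding pull_unpinned[OF H] pull_unpinned[OF assms] diff defs(1,2)[symmetric]
      by (simp add: inner_add inner_diff ss inner_commute[of s0 s] field_simps)
    also have "\<dots> = - \<kappa> * (r - r0) * (norm (s - s0))\<^sup>2 / 4"
      by (simp add: inner_unit_vectors[OF s])
    also have "norm \<dots> = \<kappa> * (\<bar>r - r0\<bar> * (norm (s - s0))\<^sup>2) / 4"
      using \<kappa>_nonneg by (simp add: abs_mult)
    also have "\<dots> \<le> \<kappa> * (\<bar>r - r0\<bar> * (norm (s - s0))\<^sup>2)"
      using \<kappa>_nonneg by simp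
    also have "\<dots> \<le> \<kappa> * (norm (pol H - pol H\<^sub>0) * (norm (s - s0))\<^sup>2)"
      using \<kappa>_nonneg norm_triangle_ineq3[of "?d H" "?d H\<^sub>0"]
      by (intro mult_left_mono mult_right_mono) (auto simp: defs)
    finally show "norm ((pull H + pull H\<^sub>0) \<bullet> (pol H - pol H\<^sub>0) / 2 - \<kappa> * (norm (?d H) - norm (?d H\<^sub>0)))
      \<le> \<kappa> * norm (norm (pol H - pol H\<^sub>0) * (?u H * ?u H))"
      by (simp add: defs power2_eq_square)
  qed
  from landau_o.big_small_trans[OF this cubic]
  show "(\<lambda>H. coenergy_pol H - coenergy_pol H\<^sub>0 - (pol H + pol H\<^sub>0) \<bullet> (H - H\<^sub>0) / 2)
      \<in> o[nhds H\<^sub>0](\<lambda>H. (norm (H - H\<^sub>0))\<^sup>2)"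
    unfolding coenergy_pol_trapezoid_identity
    using energy_pol_trapezoid by (rule sum_in_smallo(2))
qed

text \<open>An unpinned polarization has a pull of norm exactly \<open>\<kappa>\<close>, and the
  pull is continuous in the field.\<close>

lemma eventually_pinned:
  assumes "norm (pull H\<^sub>0) < \<kappa>"
  shows "\<forall>\<^sub>F H in nhds H\<^sub>0. pol H = Jp"
proof -
  have "isCont field (pol H\<^sub>0)"
    using field_has_derivative[OF norm_pol] by (rule has_derivative_continuous)
  then have "((\<lambda>H. field (pol H)) \<longlongrightarrow> field (pol H\<^sub>0)) (nhds H\<^sub>0)"
    using filterlim_compose[OF isCont_nhds pol_tendsto] by blast
  moreover have "((\<lambda>H. H) \<longlongrightarrow> H\<^sub>0) (nhds H\<^sub>0)" by (rule filterlim_ident)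
  ultimately have "((\<lambda>H. norm (pull H)) \<longlongrightarrow> norm (pull H\<^sub>0)) (nhds H\<^sub>0)"
    by (intro tendsto_intros)
  then have "\<forall>\<^sub>F H in nhds H\<^sub>0. norm (pull H) < \<kappa>" using assms by (rule order_tendstoD(2))
  then show ?thesis
  proof eventually_elim
    case (elim H)
    show ?case
    proof (rule ccontr)
      assume "pol H \<noteq> Jp"
      from pull_unpinned[OF this] this elim \<kappa>_nonneg show False by (simp add: norm_sgn)
    qed
  qed
qed

text \<open>
  At the boundary of the pinning region the change of \<open>pull\<close> is, up to second order, tangential,
  and there the inverse slope matrix is small.
\<close>

lemma semismooth_boundary:
  assumes pinned: "pol H\<^sub>0 = Jp" and boundary: "norm (pull H\<^sub>0) = \<kappa>"
  shows "(\<lambda>H. norm (pol H - pol H\<^sub>0 - jac H *v (H - H\<^sub>0))) \<in> o[nhds H\<^sub>0](\<lambda>H. norm (H - H\<^sub>0))"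
    and "(\<lambda>H. coenergy_pol H - coenergy_pol H\<^sub>0 - (pol H + pol H\<^sub>0) \<bullet> (H - H\<^sub>0) / 2)
      \<in> o[nhds H\<^sub>0](\<lambda>H. (norm (H - H\<^sub>0))\<^sup>2)"
proof -
  let ?r = "\<lambda>H. norm (pol H - pol H\<^sub>0)"
  let ?y = "\<lambda>H. norm (pull H - pull H\<^sub>0)"
  let ?q = "\<lambda>H. norm (field (pol H) - field (pol H\<^sub>0) - field' (pol H) (pol H - pol H\<^sub>0))"
  \<comment> \<open>For two vectors of norm \<open>\<kappa>\<close>, the component of their
    difference along the first is of second order. For \<open>\<kappa> = 0\<close> both pulls vanish
    and the quotient is zero.\<close>
  have radial: "sgn (pol H - Jp) \<bullet> (pull H - pull H\<^sub>0) = (?y H)\<^sup>2 / (2 * \<kappa>)" if H: "pol H \<noteq> Jp" for H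
  proof -
    define s where "s = sgn (pol H - Jp)"
    have s: "s \<bullet> s = 1" using H by (simp add: s_def norm_sgn flip: power2_norm_eq_inner)
    have y: "pull H - pull H\<^sub>0 = \<kappa> *\<^sub>R s - pull H\<^sub>0" by (simp add: pull_unpinned[OF H] s_def)
    have c: "pull H\<^sub>0 \<bullet> pull H\<^sub>0 = \<kappa> * \<kappa>"
      using boundary by (metis power2_norm_eq_inner power2_eq_square)
    have "(?y H)\<^sup>2 = 2 * \<kappa> * (s \<bullet> (pull H - pull H\<^sub>0))"
    proof -
      define c where "c = pull H\<^sub>0"
      have "(norm (\<kappa> *\<^sub>R s - c))\<^sup>2 = \<kappa> * \<kappa> - 2 * \<kappa> * (s \<bullet> c) + c \<bullet> c"
        unfolding power2_norm_eq_inner by (simp add: inner_diff inner_commute[of c s] s algebra_simps)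
      then show ?thesis unfolding y using \<open>pull H\<^sub>0 \<bullet> pull H\<^sub>0 = \<kappa> * \<kappa>\<close>
        by (simp add: c_def[symmetric] inner_diff s algebra_simps)
    qed
    moreover have "s \<bullet> (pull H - pull H\<^sub>0) = 0" if "\<kappa> = 0"
    proof -
      have "pull H\<^sub>0 = 0" using boundary that by simp
      then show ?thesis unfolding y using that by simp
    qed
    ultimately show ?thesis by (cases "\<kappa> = 0") (auto simp: s_def)
  qed
  have y: "?y \<in> O[nhds H\<^sub>0](\<lambda>H. norm (H - H\<^sub>0))"
  proof -
    have "(\<lambda>H. norm (H - H\<^sub>0) + norm (field (pol H) - field (pol H\<^sub>0))) \<in> O[nhds H\<^sub>0](\<lambda>H. norm (H - H\<^sub>0))"
      by (intro sum_in_bigo field_pol_bigo) simp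
    moreover have "?y \<in> O[nhds H\<^sub>0](\<lambda>H. norm (H - H\<^sub>0) + norm (field (pol H) - field (pol H\<^sub>0)))"
    proof (intro bigoI[of _ 1] eventuallyI)
      fix H
      have "pull H - pull H\<^sub>0 = (H - H\<^sub>0) - (field (pol H) - field (pol H\<^sub>0))" by simp
      then have "?y H \<le> norm (H - H\<^sub>0) + norm (field (pol H) - field (pol H\<^sub>0))"
        by (metis norm_triangle_ineq4)
      then show "norm (?y H) \<le> 1 * norm (norm (H - H\<^sub>0) + norm (field (pol H) - field (pol H\<^sub>0)))"
        by simp
    qed
    ultimately show ?thesis by (rule landau_o.big_trans[rotated])
  qed
  have r_lim: "(?r \<longlongrightarrow> 0) (nhds H\<^sub>0)"
  proof -
    have "(?r \<longlongrightarrow> norm (pol H\<^sub>0 - pol H\<^sub>0)) (nhds H\<^sub>0)" by (intro tendsto_intros pol_tendsto)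
    then show ?thesis by simp
  qed
  then have r1: "?r \<in> o[nhds H\<^sub>0](\<lambda>_. 1)" by (intro smalloI_tendsto) simp_all
  have y_lim: "(?y \<longlongrightarrow> 0) (nhds H\<^sub>0)"
  proof -
    have "((\<lambda>H. norm (H - H\<^sub>0)) \<longlongrightarrow> norm (H\<^sub>0 - H\<^sub>0)) (nhds H\<^sub>0)"
      by (intro isCont_nhds continuous_intros)
    then have "(\<lambda>H. norm (H - H\<^sub>0)) \<in> o[nhds H\<^sub>0](\<lambda>_. 1)" by (intro smalloI_tendsto) simp_all
    from landau_o.big_small_trans[OF y this] show ?thesis by (auto dest: smalloD_tendsto)
  qed
  \<comment> \<open>The factor left by \<open>jac_tangential\<close> once \<open>radial\<close> is
    inserted and \<open>?y H\<close> is extracted. For \<open>\<kappa> = 0\<close> the quotients are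
    zero, and so is \<open>g\<close>.\<close>
  define g where "g H = sqrt ((?y H / (2 * \<kappa> * stiffness))\<^sup>2 + ?r H / (2 * \<kappa> * stiffness))" for H
  have "(g \<longlongrightarrow> sqrt ((0 / (2 * \<kappa> * stiffness))\<^sup>2 + 0 / (2 * \<kappa> * stiffness))) (nhds H\<^sub>0)"
    unfolding g_def divide_inverse by (intro tendsto_intros r_lim y_lim)
  then have g1: "g \<in> o[nhds H\<^sub>0](\<lambda>_. 1)" by (intro smalloI_tendsto) simp_all
  have "(\<lambda>H. ?y H * g H) \<in> o[nhds H\<^sub>0](\<lambda>H. norm (H - H\<^sub>0) * 1)"
    by (intro landau_o.mult y g1)
  moreover have "(\<lambda>H. 1 / stiffness * ?q H) \<in> o[nhds H\<^sub>0](\<lambda>H. norm (H - H\<^sub>0))"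
    using field_pol_strict stiffness_pos by (simp add: landau_o.small.cmult_in_iff)
  ultimately have small: "(\<lambda>H. 1 / stiffness * ?q H + ?y H * g H) \<in> o[nhds H\<^sub>0](\<lambda>H. norm (H - H\<^sub>0))"
    by (intro sum_in_smallo) simp_all
  have "norm (pol H - pol H\<^sub>0 - jac H *v (H - H\<^sub>0)) \<le> 1 / stiffness * ?q H + ?y H * g H" for H
  proof (cases "pol H = Jp")
    case True
    have "0 \<le> g H" using \<kappa>_nonneg stiffness_pos by (simp add: g_def)
    then show ?thesis using True pinned stiffness_pos by (simp add: jac_eq)
  next
    case False
    define E where "E = field (pol H) - field (pol H\<^sub>0) - field' (pol H) (pol H - pol H\<^sub>0)"
    define y where "y = pull H - pull H\<^sub>0"
    \<comment> \<open>The displacement from \<open>Jp\<close> is purely radial, so the pinning part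
      of the slope matrix annihilates it and all of \<open>y\<close> remains. As \<open>y\<close> is
      of first order, the uniform bound on \<open>jac\<close> would not suffice; the tangential
      bound does.\<close>
    have "(sgn (pol H - Jp) \<bullet> (pol H - Jp)) *\<^sub>R sgn (pol H - Jp) = pol H - Jp"
      unfolding inner_sgn_self using False by (simp add: sgn_div_norm)
    then have "slope_matrix (pol H) *v (pol H - pol H\<^sub>0) - (H - H\<^sub>0) = - E - y"
      by (simp add: slope_matrix_mult[OF norm_pol] pinned E_def y_def)
    then have "pol H - pol H\<^sub>0 - jac H *v (H - H\<^sub>0) = jac H *v (- E) - jac H *v y"
      using jac_slope[OF False, of "pol H - pol H\<^sub>0"]
      by (metis matrix_vector_mult_diff_distrib)
    then have "norm (pol H - pol H\<^sub>0 - jac H *v (H - H\<^sub>0)) \<le> norm (jac H *v (- E)) + norm (jac H *v y)"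
      by (metis norm_triangle_ineq4)
    also have "norm (jac H *v (- E)) \<le> 1 / stiffness * norm E"
      using jac_norm[of H "- E"] by simp
    also have "norm (jac H *v y) \<le> norm y * g H"
    proof (cases "\<kappa> = 0")
      case True
      then have "y = 0" using boundary pull_unpinned[OF False] by (simp add: y_def)
      then show ?thesis by simp
    next
      case \<kappa>: False
      have "(norm (jac H *v y))\<^sup>2 \<le> ((norm y)\<^sup>2 / (2 * \<kappa>))\<^sup>2 / stiffness\<^sup>2
          + norm (pol H - Jp) * (norm y)\<^sup>2 / (2 * \<kappa> * stiffness)"
        using jac_tangential[OF False, of y] \<kappa> \<kappa>_nonneg unfolding y_def radial[OF False] by simp
      also have "\<dots> = (norm y)\<^sup>2 * ((norm y / (2 * \<kappa> * stiffness))\<^sup>2 + norm (pol H - Jp) / (2 * \<kappa> * stiffness))"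
        by (simp add: power2_eq_square distrib_left mult_ac)
      also have "\<dots> = (norm y * g H)\<^sup>2"
        using \<kappa>_nonneg stiffness_pos by (simp add: g_def y_def pinned power_mult_distrib)
      finally show ?thesis
        by (rule power2_le_imp_le) (use \<kappa>_nonneg stiffness_pos in \<open>simp add: g_def\<close>)
    qed
    finally show ?thesis by (simp add: E_def y_def)
  qed
  then have "(\<lambda>H. norm (pol H - pol H\<^sub>0 - jac H *v (H - H\<^sub>0)))
      \<in> O[nhds H\<^sub>0](\<lambda>H. 1 / stiffness * ?q H + ?y H * g H)"
    by (intro bigoI[of _ 1] eventuallyI) (auto intro: order_trans[OF _ abs_ge_self])
  then show "(\<lambda>H. norm (pol H - pol H\<^sub>0 - jac H *v (H - H\<^sub>0))) \<in> o[nhds H\<^sub>0](\<lambda>H. norm (H - H\<^sub>0))"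
    using small by (rule landau_o.big_small_trans)
  have "(\<lambda>H. ?r H * (?y H * ?y H)) \<in> o[nhds H\<^sub>0](\<lambda>H. 1 * (norm (H - H\<^sub>0) * norm (H - H\<^sub>0)))"
    by (intro landau_o.mult r1 y)
  then have cubic: "(\<lambda>H. ?r H * (?y H * ?y H)) \<in> o[nhds H\<^sub>0](\<lambda>H. (norm (H - H\<^sub>0))\<^sup>2)"
    by (simp add: power2_eq_square)
  \<comment> \<open>The component of \<open>pull H\<^sub>0\<close> along the displacement falls
    short of \<open>\<kappa>\<close> by the second-order amount in \<open>radial\<close>; the length
    of the displacement supplies the third order.\<close>
  have "(pull H + pull H\<^sub>0) \<bullet> (pol H - pol H\<^sub>0) / 2 - \<kappa> * (norm (pol H - Jp) - norm (pol H\<^sub>0 - Jp))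
      = - (1 / (4 * \<kappa>)) * (?r H * (?y H * ?y H))" for H
  proof (cases "pol H = Jp")
    case False
    define s where "s = sgn (pol H - Jp)"
    define r where "r = norm (pol H - Jp)"
    have d: "pol H - Jp = r *\<^sub>R s" using False by (simp add: r_def s_def sgn_div_norm)
    have s: "s \<bullet> s = 1" using False by (simp add: s_def norm_sgn flip: power2_norm_eq_inner)
    have "s \<bullet> (pull H - pull H\<^sub>0) = (?y H)\<^sup>2 / (2 * \<kappa>)" using radial[OF False] by (simp add: s_def)
    moreover have "s \<bullet> (pull H - pull H\<^sub>0) = \<kappa> - s \<bullet> pull H\<^sub>0"
      unfolding pull_unpinned[OF False] s_def[symmetric] by (simp add: inner_diff s)
    ultimately have "s \<bullet> pull H\<^sub>0 = \<kappa> - (?y H)\<^sup>2 / (2 * \<kappa>)" by linarith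
    moreover have "(pull H + pull H\<^sub>0) \<bullet> (r *\<^sub>R s) = r * (\<kappa> + s \<bullet> pull H\<^sub>0)"
      unfolding pull_unpinned[OF False] s_def[symmetric] by (simp add: inner_add inner_commute s distrib_left)
    ultimately have "(pull H + pull H\<^sub>0) \<bullet> (r *\<^sub>R s) = r * (2 * \<kappa> - (?y H)\<^sup>2 / (2 * \<kappa>))"
      by (simp only:) simp
    moreover have "r * (2 * \<kappa> - t\<^sup>2 / (2 * \<kappa>)) / 2 - \<kappa> * r = - (1 / (4 * \<kappa>)) * (r * (t * t))" for t
      by (simp add: power2_eq_square right_diff_distrib diff_divide_distrib)
    ultimately have "(pull H + pull H\<^sub>0) \<bullet> (pol H - Jp) / 2 - \<kappa> * r = - (1 / (4 * \<kappa>)) * (r * (?y H * ?y H))"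
      unfolding d by (simp only:)
    then show ?thesis by (simp add: pinned r_def)
  qed (simp add: pinned)
  then have "(\<lambda>H. (pull H + pull H\<^sub>0) \<bullet> (pol H - pol H\<^sub>0) / 2
      - \<kappa> * (norm (pol H - Jp) - norm (pol H\<^sub>0 - Jp))) \<in> o[nhds H\<^sub>0](\<lambda>H. (norm (H - H\<^sub>0))\<^sup>2)"
    using landau_o.big_small_mult[OF bigo_const[of "- (1 / (4 * \<kappa>))"] cubic] by (simp only: mult_1)
  then show "(\<lambda>H. coenergy_pol H - coenergy_pol H\<^sub>0 - (pol H + pol H\<^sub>0) \<bullet> (H - H\<^sub>0) / 2)
      \<in> o[nhds H\<^sub>0](\<lambda>H. (norm (H - H\<^sub>0))\<^sup>2)"
    unfolding coenergy_pol_trapezoid_identity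
    using energy_pol_trapezoid by (rule sum_in_smallo(2))
qed

text \<open>Equilibrium bounds the pull by \<open>\<kappa>\<close>, so the cases are exhaustive.
  Strictly inside the pinning region the polarization is locally constant, in agreement with the
  zero Jacobian.\<close>

lemma semismooth:
  shows "(\<lambda>H. norm (pol H - pol H\<^sub>0 - jac H *v (H - H\<^sub>0))) \<in> o[nhds H\<^sub>0](\<lambda>H. norm (H - H\<^sub>0))"
      (is ?A)
    and "(\<lambda>H. coenergy_pol H - coenergy_pol H\<^sub>0 - (pol H + pol H\<^sub>0) \<bullet> (H - H\<^sub>0) / 2)
      \<in> o[nhds H\<^sub>0](\<lambda>H. (norm (H - H\<^sub>0))\<^sup>2)" (is ?B)
proof -
  consider "pol H\<^sub>0 \<noteq> Jp" | "pol H\<^sub>0 = Jp" "norm (pull H\<^sub>0) = \<kappa>" | "pol H\<^sub>0 = Jp" "norm (pull H\<^sub>0) < \<kappa>"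
    using equilibrium_pol[of H\<^sub>0] by (fastforce simp: equilibrium_def)
  then have "?A \<and> ?B"
  proof cases
    case 1 then show ?thesis by (intro conjI semismooth_unpinned)
  next
    case 2 then show ?thesis by (intro conjI semismooth_boundary)
  next
    case 3
    have A: "\<forall>\<^sub>F H in nhds H\<^sub>0. norm (pol H - pol H\<^sub>0 - jac H *v (H - H\<^sub>0)) = 0"
      using eventually_pinned[OF 3(2)] by eventually_elim (simp add: jac_eq 3)
    have B: "\<forall>\<^sub>F H in nhds H\<^sub>0. coenergy_pol H - coenergy_pol H\<^sub>0 - (pol H + pol H\<^sub>0) \<bullet> (H - H\<^sub>0) / 2 = 0"
      using eventually_pinned[OF 3(2)]
      by eventually_elim
         (simp only: 3 inner_add_left, simp add: 3 coenergy_pol_def objective_def inner_diff_right)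
    show ?thesis
      by (intro conjI landau_o.small.in_cong[THEN iffD2, OF A] landau_o.small.in_cong[THEN iffD2, OF B]) simp_all
  qed
  then show ?A ?B by auto
qed

end

section \<open>The co-energy\<close>

text \<open>The square root of the decrease factor of the cost, since the cost controls the squared
  distance. The maximum with \<open>1 / 2\<close> keeps the rate positive.\<close>

definition armijo_rate :: "real \<Rightarrow> real \<Rightarrow> real \<Rightarrow> real \<Rightarrow> real \<Rightarrow> real \<Rightarrow> real" where
  "armijo_rate \<sigma> \<rho> c1 c2 c3 c4
    = sqrt (max (1 / 2) (1 - 2 * \<sigma> * min 1 (2 * \<rho> * (1 - \<sigma>) / (c2 * c4)) * c3 * c1))"

lemma armijo_rate_bounds:
  assumes "0 < \<sigma>" "\<sigma> < 1" "0 < \<rho>" "0 < c1" "0 < c2" "0 < c3" "0 < c4"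
  shows "0 < armijo_rate \<sigma> \<rho> c1 c2 c3 c4" "armijo_rate \<sigma> \<rho> c1 c2 c3 c4 < 1"
proof -
  have "0 < 2 * \<sigma> * min 1 (2 * \<rho> * (1 - \<sigma>) / (c2 * c4)) * c3 * c1" using assms by simp
  then show "0 < armijo_rate \<sigma> \<rho> c1 c2 c3 c4" "armijo_rate \<sigma> \<rho> c1 c2 c3 c4 < 1"
    by (simp_all add: armijo_rate_def less_max_iff_disj)
qed

context quadratic_sandwich
begin

lemma line_search_linear:
  assumes \<sigma>: "0 < \<sigma>" "\<sigma> < 1" and \<rho>: "0 < \<rho>" "\<rho> < 1" and c: "0 < c3" "c3 \<le> c4"
    and iter: "line_search_iterates f \<sigma> \<rho> S H"
    and S: "\<And>n. sym_pos_def (S n)" "\<And>n l. eigenvalue (S n) l \<Longrightarrow> c3 \<le> l \<and> l \<le> c4"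
    and z: "g z = 0"
  shows "norm (H n - z) \<le> sqrt (L / m) * armijo_rate \<sigma> \<rho> m L c3 c4 ^ n * norm (H 0 - z)"
  unfolding armijo_rate_def
proof (rule linear_convergence[OF \<sigma> \<rho> c(1), where b = c4 and d = "\<lambda>n. - (S n *v g (H n))"])
  fix n
  show "H (Suc n) = H n + armijo_step f \<sigma> \<rho> (H n) (- (S n *v g (H n))) *\<^sub>R - (S n *v g (H n))"
    using iter by (simp add: line_search_iterates_def Let_def gradient_f)
  have sym: "transpose (S n) = S n" using S(1)[of n] by (auto simp: sym_pos_def_def)
  have low: "c3 * (norm x)\<^sup>2 \<le> x \<bullet> (S n *v x)" for x
    using rayleigh_lower[OF sym] S(2) by blast
  have up: "x \<bullet> (S n *v x) \<le> c4 * (norm x)\<^sup>2" for x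
    using rayleigh_upper[OF sym] S(2) by blast
  have nonneg: "0 \<le> x \<bullet> (S n *v x)" for x
    using low[of x] c(1) by (smt (verit) mult_nonneg_nonneg zero_le_power2)
  show "c3 * (norm (g (H n)))\<^sup>2 \<le> - (g (H n) \<bullet> - (S n *v g (H n)))" using low by simp
  show "(norm (- (S n *v g (H n))))\<^sup>2 \<le> c4 * - (g (H n) \<bullet> - (S n *v g (H n)))"
    using norm_matrix_vector_squared_le[OF sym _ nonneg up] c by simp
qed (use c z in auto)

lemma line_search_tendsto:
  assumes \<sigma>: "0 < \<sigma>" "\<sigma> < 1" and \<rho>: "0 < \<rho>" "\<rho> < 1" and c: "0 < c3" "c3 \<le> c4"
    and iter: "line_search_iterates f \<sigma> \<rho> S H"
    and S: "\<And>n. sym_pos_def (S n)" "\<And>n l. eigenvalue (S n) l \<Longrightarrow> c3 \<le> l \<and> l \<le> c4"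
    and z: "g z = 0"
  shows "H \<longlonglongrightarrow> z"
proof -
  have power_lim: "(\<lambda>n. armijo_rate \<sigma> \<rho> m L c3 c4 ^ n) \<longlonglongrightarrow> 0"
    using armijo_rate_bounds[OF \<sigma> \<rho>(1) m_pos L_pos c(1), of c4] c by (intro LIMSEQ_realpow_zero) auto
  have "(\<lambda>n. sqrt (L / m) * armijo_rate \<sigma> \<rho> m L c3 c4 ^ n * norm (H 0 - z))
      \<longlonglongrightarrow> sqrt (L / m) * 0 * norm (H 0 - z)"
    by (intro tendsto_mult tendsto_const power_lim)
  then have lim: "(\<lambda>n. sqrt (L / m) * armijo_rate \<sigma> \<rho> m L c3 c4 ^ n * norm (H 0 - z)) \<longlonglongrightarrow> 0"
    by (simp only: mult_zero_left mult_zero_right)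
  have "(\<lambda>n. H n - z) \<longlonglongrightarrow> 0"
    by (rule Lim_null_comparison[OF _ lim]) (intro always_eventually allI line_search_linear[OF assms])
  then show ?thesis by (simp add: Lim_null[symmetric])
qed

end

locale polarization_model =
  fixes K :: "nat set" and \<mu>0 As :: real and Js \<kappa> :: "nat \<Rightarrow> real" and Jp :: "nat \<Rightarrow> real^3"
    and B :: "real^3"
  assumes finite_K: "finite K" and \<mu>0_pos: "0 < \<mu>0"
    and pinning: "\<And>k. k \<in> K \<Longrightarrow> pinning As (Js k) (\<kappa> k)"
begin

definition cost :: "real^3 \<Rightarrow> real" where
  "cost H = coenergy K \<mu>0 As Js \<kappa> Jp H - B \<bullet> H"

abbreviation w :: "nat \<Rightarrow> real^3 \<Rightarrow> real" where
  "w k \<equiv> pinning.coenergy_pol As (Js k) (\<kappa> k) (Jp k)"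

abbreviation pol :: "nat \<Rightarrow> real^3 \<Rightarrow> real^3" where
  "pol k \<equiv> polarization As (Js k) (\<kappa> k) (Jp k)"

abbreviation jac :: "nat \<Rightarrow> real^3 \<Rightarrow> real^3^3" where
  "jac k \<equiv> gen_jacobian_pol As (Js k) (\<kappa> k) (Jp k)"

abbreviation total_jac :: "real^3 \<Rightarrow> real^3^3" where
  "total_jac \<equiv> gen_jacobian K \<mu>0 As Js \<kappa> Jp"

abbreviation st :: "nat \<Rightarrow> real" where
  "st k \<equiv> pinning.stiffness As (Js k)"

definition cost_grad :: "real^3 \<Rightarrow> real^3" where
  "cost_grad H = \<mu>0 *\<^sub>R H + (\<Sum>k\<in>K. pol k H) - B"

definition upper_modulus :: real where
  "upper_modulus = \<mu>0 + (\<Sum>k\<in>K. 1 / st k)"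

lemma upper_modulus_eq: "upper_modulus = \<mu>0 + 2 * (\<Sum>k\<in>K. Js k) / (As * pi)"
proof -
  have "1 / st k = 2 * Js k / (As * pi)" if "k \<in> K" for k
    by (simp add: pinning.stiffness_def[OF pinning[OF that]])
  then have "(\<Sum>k\<in>K. 1 / st k) = (\<Sum>k\<in>K. 2 * Js k / (As * pi))" by (intro sum.cong) auto
  then show ?thesis by (simp add: upper_modulus_def sum_divide_distrib sum_distrib_left)
qed

lemma cost_eq: "cost H = \<mu>0 / 2 * (norm H)\<^sup>2 + (\<Sum>k\<in>K. w k H) - B \<bullet> H"
proof -
  have "(\<Sum>k\<in>K. real_of_ereal (INF J. pol_energy As (Js k) (\<kappa> k) (Jp k) H J)) = (\<Sum>k\<in>K. - w k H)"
    using pinning.min_pol_energy[OF pinning] pinning.coenergy_pol_def[OF pinning]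
    by (intro sum.cong) auto
  then show ?thesis by (simp add: cost_def coenergy_def sum_negf)
qed

lemma norm_expand:
  "\<mu>0 / 2 * (norm y)\<^sup>2 = \<mu>0 / 2 * (norm x)\<^sup>2 + (\<mu>0 *\<^sub>R x) \<bullet> (y - x) + \<mu>0 / 2 * (norm (y - x))\<^sup>2"
  for x y :: "real^3"
  by (simp add: power2_norm_eq_inner inner_diff inner_commute algebra_simps)

text \<open>The strong convexity comes from the magnetic term alone, each \<open>w k\<close>
  contributing convexity; to the upper constant each adds the reciprocal of its stiffness.\<close>

sublocale quadratic_sandwich cost cost_grad \<mu>0 upper_modulus
proof
  show "0 < \<mu>0" by (rule \<mu>0_pos)
  show "\<mu>0 \<le> upper_modulus"
    using sum_nonneg[of K "\<lambda>k. 1 / st k"] pinning.stiffness_pos[OF pinning]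
    by (simp add: upper_modulus_def less_imp_le)
  fix x y
  have lin: "cost_grad x \<bullet> (y - x) = (\<mu>0 *\<^sub>R x) \<bullet> (y - x) + (\<Sum>k\<in>K. pol k x \<bullet> (y - x)) - (B \<bullet> y - B \<bullet> x)"
    by (simp add: cost_grad_def inner_add_left inner_diff_left inner_sum_left inner_diff_right
        sum_subtractf)
  have "(\<Sum>k\<in>K. w k x + pol k x \<bullet> (y - x)) \<le> (\<Sum>k\<in>K. w k y)"
    by (intro sum_mono pinning.coenergy_pol_lower pinning)
  then show "cost x + cost_grad x \<bullet> (y - x) + \<mu>0 / 2 * (norm (y - x))\<^sup>2 \<le> cost y"
    unfolding cost_eq lin norm_expand[of y x] by (simp add: sum.distrib)
  have "(\<Sum>k\<in>K. w k y) \<le> (\<Sum>k\<in>K. w k x + pol k x \<bullet> (y - x) + 1 / st k / 2 * (norm (y - x))\<^sup>2)"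
    by (intro sum_mono pinning.coenergy_pol_upper pinning)
  also have "\<dots> = (\<Sum>k\<in>K. w k x) + (\<Sum>k\<in>K. pol k x \<bullet> (y - x)) + (\<Sum>k\<in>K. 1 / st k) / 2 * (norm (y - x))\<^sup>2"
    by (simp add: sum.distrib sum_distrib_right sum_divide_distrib)
  finally show "cost y \<le> cost x + cost_grad x \<bullet> (y - x) + upper_modulus / 2 * (norm (y - x))\<^sup>2"
    unfolding cost_eq lin norm_expand[of y x] upper_modulus_def
    by (simp add: add_divide_distrib distrib_right)
qed

lemma total_jac_mult: "total_jac H *v v = \<mu>0 *\<^sub>R v + (\<Sum>k\<in>K. jac k H *v v)"
proof -
  have "(\<Sum>k\<in>K. jac k H) *v v = (\<Sum>k\<in>K. jac k H *v v)"
    using finite_K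
    by (induction K rule: finite_induct) (simp_all add: matrix_vector_mult_add_rdistrib)
  then show ?thesis
    by (simp add: gen_jacobian_def matrix_vector_mult_add_rdistrib scaleR_matrix_vector_assoc[symmetric])
qed

lemma total_jac_sym: "transpose (total_jac H) = total_jac H"
  unfolding transpose_eq_iff
proof (intro allI)
  fix x y
  have "x \<bullet> (jac k H *v y) = (jac k H *v x) \<bullet> y" if "k \<in> K" for k
    using pinning.jac_sym[OF pinning[OF that]] transpose_eq_iff by blast
  then show "x \<bullet> (total_jac H *v y) = (total_jac H *v x) \<bullet> y"
    by (simp add: total_jac_mult inner_add inner_sum_left inner_sum_right)
qed

lemma inner_total_jac: "v \<bullet> (total_jac H *v v) = \<mu>0 * (norm v)\<^sup>2 + (\<Sum>k\<in>K. v \<bullet> (jac k H *v v))"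
  by (simp add: total_jac_mult inner_add_right inner_sum_right power2_norm_eq_inner)

lemma total_jac_lower: "\<mu>0 * (norm v)\<^sup>2 \<le> v \<bullet> (total_jac H *v v)"
  unfolding inner_total_jac using pinning.jac_nonneg[OF pinning] by (simp add: sum_nonneg)

lemma total_jac_upper: "v \<bullet> (total_jac H *v v) \<le> upper_modulus * (norm v)\<^sup>2"
proof -
  have "(\<Sum>k\<in>K. v \<bullet> (jac k H *v v)) \<le> (\<Sum>k\<in>K. 1 / st k * (norm v)\<^sup>2)"
    by (intro sum_mono pinning.jac_upper pinning)
  then show ?thesis
    unfolding inner_total_jac upper_modulus_def by (simp add: distrib_right sum_distrib_right)
qed

lemmas total_jac_facts = total_jac_sym \<mu>0_pos total_jac_lower

text \<open>As \<open>cost_grad z = 0\<close>, the Newton error is minus the inverse Jacobian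
  applied to the linearization error of \<open>cost_grad\<close>. The \<open>\<mu>0\<close> terms
  cancel, single-polarization errors remain, and the inverse is bounded by \<open>1 / \<mu>0\<close>
  uniformly in \<open>H\<close>.\<close>

lemma newton_small:
  assumes z: "cost_grad z = 0"
  shows "(\<lambda>H. norm (H + - (matrix_inv (total_jac H) *v cost_grad H) - z)) \<in> o[nhds z](\<lambda>H. norm (H - z))"
proof -
  let ?E = "\<lambda>k H. pol k H - pol k z - jac k H *v (H - z)"
  have "(\<lambda>H. \<Sum>k\<in>K. norm (?E k H)) \<in> o[nhds z](\<lambda>H. norm (H - z))"
    by (intro big_sum_in_smallo pinning.semismooth pinning)
  moreover have "(\<lambda>H. norm (H + - (matrix_inv (total_jac H) *v cost_grad H) - z))
      \<in> O[nhds z](\<lambda>H. \<Sum>k\<in>K. norm (?E k H))"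
  proof (intro bigoI[of _ "1 / \<mu>0"] eventuallyI)
    fix H
    have "cost_grad H = cost_grad H - cost_grad z" using z by simp
    also have "\<dots> = total_jac H *v (H - z) + (\<Sum>k\<in>K. ?E k H)"
      by (simp add: cost_grad_def total_jac_mult sum_subtractf scaleR_diff_right)
    finally have "matrix_inv (total_jac H) *v cost_grad H
        = (H - z) + matrix_inv (total_jac H) *v (\<Sum>k\<in>K. ?E k H)"
      by (simp add: matrix_vector_right_distrib coercive_inv(2)[OF total_jac_facts])
    then have "norm (H + - (matrix_inv (total_jac H) *v cost_grad H) - z)
        = norm (matrix_inv (total_jac H) *v (\<Sum>k\<in>K. ?E k H))" by simp
    also have "\<dots> \<le> norm (\<Sum>k\<in>K. ?E k H) / \<mu>0" by (rule coercive_inv_norm[OF total_jac_facts])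
    also have "\<dots> \<le> (\<Sum>k\<in>K. norm (?E k H)) / \<mu>0"
      using \<mu>0_pos by (intro divide_right_mono norm_sum) simp
    finally show "norm (norm (H + - (matrix_inv (total_jac H) *v cost_grad H) - z))
        \<le> 1 / \<mu>0 * norm (\<Sum>k\<in>K. norm (?E k H))"
      by (simp add: sum_nonneg)
  qed
  ultimately show ?thesis by (rule landau_o.big_small_trans[rotated])
qed

text \<open>Quadratic and linear terms obey the trapezoidal rule exactly, so only the defects of the
  \<open>w k\<close> remain; the gradient at the end point \<open>z\<close> vanishes.\<close>

lemma cost_trapezoid:
  assumes z: "cost_grad z = 0"
  shows "(\<lambda>H. cost H - cost z - cost_grad H \<bullet> (H - z) / 2) \<in> o[nhds z](\<lambda>H. (norm (H - z))\<^sup>2)"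
proof -
  have "cost H - cost z - cost_grad H \<bullet> (H - z) / 2
      = (\<Sum>k\<in>K. w k H - w k z - (pol k H + pol k z) \<bullet> (H - z) / 2)" for H
  proof -
    have "cost_grad H \<bullet> (H - z) = (cost_grad H + cost_grad z) \<bullet> (H - z)" using z by simp
    also have "\<dots> = \<mu>0 * (norm H)\<^sup>2 - \<mu>0 * (norm z)\<^sup>2 + (\<Sum>k\<in>K. (pol k H + pol k z) \<bullet> (H - z)) - 2 * (B \<bullet> H - B \<bullet> z)"
    proof -
      have "cost_grad H + cost_grad z = \<mu>0 *\<^sub>R (H + z) + (\<Sum>k\<in>K. pol k H + pol k z) - 2 *\<^sub>R B"
        by (simp add: cost_grad_def sum.distrib scaleR_add_right scaleR_2)
      moreover have "(H + z) \<bullet> (H - z) = (norm H)\<^sup>2 - (norm z)\<^sup>2"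
        by (simp add: power2_norm_eq_inner inner_add inner_diff inner_commute)
      ultimately show ?thesis
        by (simp only: inner_diff_left inner_add_left inner_sum_left inner_scaleR_left right_diff_distrib
            inner_diff_right[of B])
    qed
    finally have g: "cost_grad H \<bullet> (H - z) = \<dots>" .
    have "a / 2 * x + W - b - (a / 2 * y + V - c) - (a * x - a * y + S - 2 * (b - c)) / 2 = W - V - S / 2"
      for a x y b c W V S :: real by (simp add: field_simps)
    then show ?thesis
      unfolding cost_eq g sum_subtractf sum_divide_distrib[symmetric] .
  qed
  moreover have "(\<lambda>H. \<Sum>k\<in>K. w k H - w k z - (pol k H + pol k z) \<bullet> (H - z) / 2)
      \<in> o[nhds z](\<lambda>H. (norm (H - z))\<^sup>2)"
    by (intro big_sum_in_smallo pinning.semismooth pinning)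
  ultimately show ?thesis by simp
qed

text \<open>The eigenvalues of the inverse Jacobians lie between \<open>1 / upper_modulus\<close>
  and \<open>1 / \<mu>0\<close>, so the linear result yields convergence and brings the tail into
  the range of the local estimates at \<open>z\<close>.\<close>

lemma newton_superlinear:
  assumes \<sigma>: "0 < \<sigma>" "\<sigma> < 1 / 2" and \<rho>: "0 < \<rho>" "\<rho> < 1" and z: "cost_grad z = 0"
    and iter: "line_search_iterates cost \<sigma> \<rho> S H" and S: "\<And>n. S n = matrix_inv (total_jac (H n))"
  shows "H \<longlonglongrightarrow> z" and "(\<lambda>n. norm (H (Suc n) - z)) \<in> o(\<lambda>n. norm (H n - z))"
proof -
  show lim: "H \<longlonglongrightarrow> z"
  proof (rule line_search_tendsto[OF \<sigma>(1) _ \<rho> _ _ iter _ _ z])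
    show "sym_pos_def (S n)" for n unfolding S by (rule coercive_inv_sym_pos_def[OF total_jac_facts])
    show "1 / upper_modulus \<le> l \<and> l \<le> 1 / \<mu>0" if "eigenvalue (S n) l" for n l
      using that coercive_inv_eigenvalue[OF total_jac_facts total_jac_upper] unfolding S by blast
    show "1 / upper_modulus \<le> 1 / \<mu>0" using m_le_L m_pos by (simp add: frac_le)
  qed (use \<sigma> L_pos in auto)
  show "(\<lambda>n. norm (H (Suc n) - z)) \<in> o(\<lambda>n. norm (H n - z))"
    using iter unfolding line_search_iterates_def Let_def gradient_f S
    by (intro superlinear_convergence[OF \<sigma> \<rho> z lim _ newton_small[OF z] cost_trapezoid[OF z]]) blast
qed

end

text \<open>Choosing the rate function before all model data expresses that the rate depends on
  \<open>c1\<close> to \<open>c4\<close> alone once the line search is fixed. The constant is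
  \<open>sqrt (c2 / c1)\<close>, the same for all matrices and starting points.\<close>

theorem theorem1:
  fixes \<sigma> \<rho> :: real
  assumes "0 < \<sigma>" and "\<sigma> < 1 / 2" and "0 < \<rho>" and "\<rho> < 1"
  shows "\<exists>q :: real \<Rightarrow> real \<Rightarrow> real \<Rightarrow> real \<Rightarrow> real.
    \<forall>(K :: nat set) (\<mu>0 :: real) (As :: real) (Js :: nat \<Rightarrow> real) (\<kappa> :: nat \<Rightarrow> real)
      (Jp :: nat \<Rightarrow> real^3) (B :: real^3) (f :: real^3 \<Rightarrow> real) (c1 :: real) (c2 :: real).
      finite K \<and> 0 < \<mu>0 \<and> 0 < As \<and> (\<forall>k\<in>K. 0 < Js k \<and> 0 \<le> \<kappa> k)
      \<and> f = (\<lambda>H. coenergy K \<mu>0 As Js \<kappa> Jp H - B \<bullet> H)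
      \<and> c1 = \<mu>0 \<and> c2 = \<mu>0 + 2 * (\<Sum>k\<in>K. Js k) / (As * pi)
      \<longrightarrow>
      (\<exists>!Hmin. is_arg_min f (\<lambda>_. True) Hmin) \<and>
      (\<forall>Hmin. is_arg_min f (\<lambda>_. True) Hmin \<longrightarrow>
        (\<forall>c3 c4. 0 < c3 \<and> c3 \<le> c4 \<longrightarrow>
          0 < q c1 c2 c3 c4 \<and> q c1 c2 c3 c4 < 1 \<and>
          (\<exists>C>0. \<forall>(S :: nat \<Rightarrow> real^3^3) (H :: nat \<Rightarrow> real^3).
            line_search_iterates f \<sigma> \<rho> S H \<and>
            (\<forall>n. sym_pos_def (S n) \<and> (\<forall>l. eigenvalue (S n) l \<longrightarrow> c3 \<le> l \<and> l \<le> c4))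
            \<longrightarrow>
            H \<longlonglongrightarrow> Hmin \<and>
            (\<forall>n. norm (H n - Hmin) \<le> C * q c1 c2 c3 c4 ^ n * norm (H 0 - Hmin)))) \<and>
        (\<forall>(S :: nat \<Rightarrow> real^3^3) (H :: nat \<Rightarrow> real^3).
          line_search_iterates f \<sigma> \<rho> S H \<and>
          (\<forall>n. S n = matrix_inv (gen_jacobian K \<mu>0 As Js \<kappa> Jp (H n)))
          \<longrightarrow>
          H \<longlonglongrightarrow> Hmin \<and>
          (\<lambda>n. norm (H (Suc n) - Hmin)) \<in> o(\<lambda>n. norm (H n - Hmin))))"
proof (rule exI[of _ "armijo_rate \<sigma> \<rho>"], intro allI impI, elim conjE)
  fix K :: "nat set" and \<mu>0 As :: real and Js \<kappa> :: "nat \<Rightarrow> real" and Jp :: "nat \<Rightarrow> real^3"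
    and B :: "real^3" and f :: "real^3 \<Rightarrow> real" and c1 c2 :: real
  assume hyps: "finite K" "0 < \<mu>0" "0 < As" "\<forall>k\<in>K. 0 < Js k \<and> 0 \<le> \<kappa> k"
    and f: "f = (\<lambda>H. coenergy K \<mu>0 As Js \<kappa> Jp H - B \<bullet> H)"
    and c1: "c1 = \<mu>0" and c2: "c2 = \<mu>0 + 2 * (\<Sum>k\<in>K. Js k) / (As * pi)"
  interpret polarization_model K \<mu>0 As Js \<kappa> Jp B
    by unfold_locales (use hyps in auto)
  have f: "f = cost" unfolding f cost_def[abs_def] ..
  have c2: "c2 = upper_modulus" unfolding c2 upper_modulus_eq ..
  have \<sigma>: "\<sigma> < 1" using assms by simp
  show "(\<exists>!Hmin. is_arg_min f (\<lambda>_. True) Hmin) \<and>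
      (\<forall>Hmin. is_arg_min f (\<lambda>_. True) Hmin \<longrightarrow>
        (\<forall>c3 c4. 0 < c3 \<and> c3 \<le> c4 \<longrightarrow>
          0 < armijo_rate \<sigma> \<rho> c1 c2 c3 c4 \<and> armijo_rate \<sigma> \<rho> c1 c2 c3 c4 < 1 \<and>
          (\<exists>C>0. \<forall>(S :: nat \<Rightarrow> real^3^3) (H :: nat \<Rightarrow> real^3).
            line_search_iterates f \<sigma> \<rho> S H \<and>
            (\<forall>n. sym_pos_def (S n) \<and> (\<forall>l. eigenvalue (S n) l \<longrightarrow> c3 \<le> l \<and> l \<le> c4))
            \<longrightarrow>
            H \<longlonglongrightarrow> Hmin \<and>
            (\<forall>n. norm (H n - Hmin) \<le> C * armijo_rate \<sigma> \<rho> c1 c2 c3 c4 ^ n * norm (H 0 - Hmin)))) \<and>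
        (\<forall>(S :: nat \<Rightarrow> real^3^3) (H :: nat \<Rightarrow> real^3).
          line_search_iterates f \<sigma> \<rho> S H \<and>
          (\<forall>n. S n = matrix_inv (gen_jacobian K \<mu>0 As Js \<kappa> Jp (H n)))
          \<longrightarrow>
          H \<longlonglongrightarrow> Hmin \<and>
          (\<lambda>n. norm (H (Suc n) - Hmin)) \<in> o(\<lambda>n. norm (H n - Hmin))))"
    unfolding f c1 c2
  proof (intro conjI allI impI ex1_min; (elim conjE)?)
    fix z c3 c4 assume z: "is_arg_min cost (\<lambda>_. True) z" and c: "0 < c3" "c3 \<le> (c4::real)"
    have z: "cost_grad z = 0" using z by (rule gradient_zero_iff_min[THEN iffD1])
    show "0 < armijo_rate \<sigma> \<rho> \<mu>0 upper_modulus c3 c4" "armijo_rate \<sigma> \<rho> \<mu>0 upper_modulus c3 c4 < 1"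
      using assms c \<sigma> L_pos m_pos by (auto intro!: armijo_rate_bounds)
    show "\<exists>C>0. \<forall>S H. line_search_iterates cost \<sigma> \<rho> S H \<and>
        (\<forall>n. sym_pos_def (S n) \<and> (\<forall>l. eigenvalue (S n) l \<longrightarrow> c3 \<le> l \<and> l \<le> c4)) \<longrightarrow>
        H \<longlonglongrightarrow> z \<and>
        (\<forall>n. norm (H n - z) \<le> C * armijo_rate \<sigma> \<rho> \<mu>0 upper_modulus c3 c4 ^ n * norm (H 0 - z))"
    proof (intro exI[of _ "sqrt (upper_modulus / \<mu>0)"] conjI allI impI; (elim conjE)?)
      show "0 < sqrt (upper_modulus / \<mu>0)" using L_pos m_pos by simp
      fix S :: "nat \<Rightarrow> real^3^3" and H :: "nat \<Rightarrow> real^3"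
      assume iter: "line_search_iterates cost \<sigma> \<rho> S H"
        and S: "\<forall>n. sym_pos_def (S n) \<and> (\<forall>l. eigenvalue (S n) l \<longrightarrow> c3 \<le> l \<and> l \<le> c4)"
      show "H \<longlonglongrightarrow> z"
        by (rule line_search_tendsto[OF assms(1) \<sigma> assms(3,4) c iter _ _ z]) (use S in auto)
      show "norm (H n - z)
          \<le> sqrt (upper_modulus / \<mu>0) * armijo_rate \<sigma> \<rho> \<mu>0 upper_modulus c3 c4 ^ n * norm (H 0 - z)" for n
        by (rule line_search_linear[OF assms(1) \<sigma> assms(3,4) c iter _ _ z]) (use S in auto)
    qed
  next
    fix z S H assume z: "is_arg_min cost (\<lambda>_. True) z"
      and *: "line_search_iterates cost \<sigma> \<rho> S H"
        "\<forall>n. S n = matrix_inv (gen_jacobian K \<mu>0 As Js \<kappa> Jp (H n))"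
    have z: "cost_grad z = 0" using z by (rule gradient_zero_iff_min[THEN iffD1])
    show "H \<longlonglongrightarrow> z" "(\<lambda>n. norm (H (Suc n) - z)) \<in> o(\<lambda>n. norm (H n - z))"
      using newton_superlinear[OF assms z *(1)] *(2) by auto
  qed
qed

end
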